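(* For every integer $n\ge 3$ and every $c\in(0,1)$, the class $\mathcal{GT}(n,c)$ has no bi-Lipschitz universal element. In fact, the class $$\bigcup_{\substack{n\ge 3\\ c\in(0,1)}}\mathcal{GT}(n,c)$$ has no bi-Lipschitz universal element.
   Context: A metric tree is a compact, connected, locally connected metric space containing no simple closed curve; equivalently every two distinct points $x,y$ are the endpoints of a unique arc $[x,y]_T$. A metric tree $T$ is geodesic if each arc $[x,y]_T$ is isometric to the interval $[0,d_T(x,y)]$. For $p\in T$, the connected components of $T\setminus\{p\}$ are the branches of $T$ at $p$, denoted $B_1^T(p),B_2^T(p),\ldots$ and arranged so that their diameters are nonincreasing; the valence $\operatorname{val}_T(p)$ is the number of these components, and $\operatorname{Val}(T)=\sup_{p\in T}\operatorname{val}_T(p)$. A point $p$ is a branch point if $\operatorname{val}_T(p)\ge 3$; its height is $H_T(p)=\operatorname{diam} B_3^T(p)$; $\mathcal B(T)$ is the set of branch points. For an integer $n\ge 2$ and $c\in(0,1]$, $\mathcal{GT}(n,c)$ is the class of geodesic metric trees $T$ with $\operatorname{Val}(T)\le n$ and $d_T(p,q)\ge c\min\{H_T(p),H_T(q)\}$ for all distinct $p,q\in\mathcal B(T)$. A map $f:X\to Y$ between metric spaces is a bi-Lipschitz embedding if there are constants $k,K>0$ with $\frac1k d(x,y)\le d(f(x),f(y))\le K d(x,y)$ for all $x,y\in X$. A member $U$ of a class $\mathcal C$ of metric spaces is bi-Lipschitz universal for $\mathcal C$ if every member of $\mathcal C$ admits a bi-Lipschitz embedding into $U$ (the constants are allowed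 to depend on the member). *)

theory Defs
  imports "HOL-Analysis.Analysis" "HOL-Library.Extended_Nat"
begin

definition isometric_spaces :: "'a metric \<Rightarrow> 'b metric \<Rightarrow> bool" where
  "isometric_spaces M N \<longleftrightarrow>
     (\<exists>f. f ` mspace M = mspace N \<and>
          (\<forall>x\<in>mspace M. \<forall>y\<in>mspace M. mdist N (f x) (f y) = mdist M x y))"

definition mdiam :: "'a metric \<Rightarrow> 'a set \<Rightarrow> real" where
  "mdiam M S = (SUP (x, y)\<in>S \<times> S. mdist M x y)"

definition simple_closed_curve_in :: "'a topology \<Rightarrow> 'a set \<Rightarrow> bool" where
  "simple_closed_curve_in X S \<longleftrightarrow>
     S \<subseteq> topspace X \<and> subtopology X S homeomorphic_space top_of_set (sphere (0::complex) 1)"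

definition arc_between :: "'a topology \<Rightarrow> 'a \<Rightarrow> 'a \<Rightarrow> 'a set \<Rightarrow> bool" where
  "arc_between X x y A \<longleftrightarrow>
     (\<exists>g. embedding_map (top_of_set {0..1::real}) X g \<and> g 0 = x \<and> g 1 = y \<and> A = g ` {0..1})"

definition metric_tree :: "'a metric \<Rightarrow> bool" where
  "metric_tree T \<longleftrightarrow>
     mspace T \<noteq> {} \<and>
     compact_space (mtopology_of T) \<and>
     connected_space (mtopology_of T) \<and>
     locally_connected_space (mtopology_of T) \<and>
     (\<nexists>S. simple_closed_curve_in (mtopology_of T) S)"

text \<open>In a metric tree any two distinct points are the endpoints of exactly one arc, so the
  existential quantifier below refers to that arc.\<close>

definition geodesic_tree :: "'a metric \<Rightarrow> bool" where
  "geodesic_tree T \<longleftrightarrow>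
     metric_tree T \<and>
     (\<forall>x\<in>mspace T. \<forall>y\<in>mspace T. x \<noteq> y \<longrightarrow>
        (\<exists>A. arc_between (mtopology_of T) x y A \<and>
             isometric_spaces (submetric T A) (submetric euclidean_metric {0..mdist T x y})))"

definition branches :: "'a metric \<Rightarrow> 'a \<Rightarrow> 'a set set" where
  "branches T p = connected_components_of (subtopology (mtopology_of T) (mspace T - {p}))"

definition valence :: "'a metric \<Rightarrow> 'a \<Rightarrow> enat" where
  "valence T p = (if finite (branches T p) then enat (card (branches T p)) else \<infinity>)"

definition Val :: "'a metric \<Rightarrow> enat" where
  "Val T = (SUP p\<in>mspace T. valence T p)"

text \<open>An enumeration \<open>B 1, B 2, \<dots>\<close> (starting at index 1) of the branches at \<open>p\<close>, with
  nonincreasing diameters.\<close>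

definition branch_enumeration :: "'a metric \<Rightarrow> 'a \<Rightarrow> (nat \<Rightarrow> 'a set) \<Rightarrow> bool" where
  "branch_enumeration T p B \<longleftrightarrow>
     (let I = {i. 1 \<le> i \<and> enat i \<le> valence T p} in
        bij_betw B I (branches T p) \<and>
        (\<forall>i\<in>I. \<forall>j\<in>I. i \<le> j \<longrightarrow> mdiam T (B j) \<le> mdiam T (B i)))"

definition branch_points :: "'a metric \<Rightarrow> 'a set" where
  "branch_points T = {p \<in> mspace T. valence T p \<ge> 3}"

text \<open>Ties between equal diameters may be broken arbitrarily: the diameter of the third branch
  is the same for every such enumeration. The value is meaningful at branch points only.\<close>

definition height :: "'a metric \<Rightarrow> 'a \<Rightarrow> real" where
  "height T p = mdiam T ((SOME B. branch_enumeration T p B) 3)"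

definition GT :: "nat \<Rightarrow> real \<Rightarrow> 'a metric set" where
  "GT n c = {T. geodesic_tree T \<and> Val T \<le> enat n \<and>
     (\<forall>p\<in>branch_points T. \<forall>q\<in>branch_points T.
        p \<noteq> q \<longrightarrow> mdist T p q \<ge> c * min (height T p) (height T q))}"

definition bilipschitz_embedding :: "'a metric \<Rightarrow> 'b metric \<Rightarrow> ('a \<Rightarrow> 'b) \<Rightarrow> bool" where
  "bilipschitz_embedding M N f \<longleftrightarrow>
     f \<in> mspace M \<rightarrow> mspace N \<and>
     (\<exists>k>0. \<exists>K>0. \<forall>x\<in>mspace M. \<forall>y\<in>mspace M.
        1 / k * mdist M x y \<le> mdist N (f x) (f y) \<and> mdist N (f x) (f y) \<le> K * mdist M x y)"

text \<open>Membership of \<open>U\<close> in the class is stated separately, so that \<open>U\<close> and the members of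
  \<open>C\<close> may have points of different types. A class of compact metric spaces is represented in full
  by its members of type \<^typ>\<open>real metric\<close>: a compact metric space has at most continuum many
  points, hence is isometric to one whose carrier is a set of reals (with an arbitrary metric).\<close>

definition bilipschitz_universal :: "'a metric \<Rightarrow> 'b metric set \<Rightarrow> bool" where
  "bilipschitz_universal U C \<longleftrightarrow> (\<forall>T\<in>C. \<exists>f. bilipschitz_embedding T U f)"

end

theory Submission
  imports Defs "HOL-Probability.Discrete_Topology"
begin

text \<open>
  The reason is a rigidity at infinitely many scales. It is shown that no member \<open>U\<close> of any
  class \<open>GT n c\<close> with \<open>c > 0\<close> contains bi-Lipschitz copies of all members of \<open>GT 3 1\<close>
  (\<open>GT_not_universal\<close>); both claims follow at once, as \<open>GT 3 1\<close> is contained in every \<open>GT n c\<close>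
  with \<open>n \<ge> 3\<close> and \<open>0 < c \<le> 1\<close>.

  The tree that \<open>U\<close> does not contain is a comb: the segment \<open>[0,1]\<close> with a
  hair of length \<open>h x\<close> attached at every \<open>x\<close>. It belongs to \<open>GT 3 1\<close> as soon as any two feet
  \<open>x \<noteq> y\<close> satisfy \<open>min (h x) (h y) \<le> \<bar>x - y\<bar>\<close> (\<open>comb_in_GT\<close>). Suppose that \<open>f\<close> embeds the comb
  in \<open>U\<close> with constant \<open>k\<close>. An injective path in a tree runs along a geodesic
  (\<open>geodesic_tree_injective_path_between\<close>), so \<open>f\<close> maps the base onto a geodesic segment, where it
  is an increasing \<open>k\<close>-bi-Lipschitz function \<open>g\<close>. At a foot \<open>x\<close> there are three arms of length at
  least \<open>h x\<close>, so the image of \<open>x\<close> is a branch point of \<open>U\<close> of height at least \<open>h x / (2 * k)\<close>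
  (\<open>foot_image_high_branch_point\<close>). The positions of such branch points on the segment form a set
  \<open>X (h x)\<close> whose points are separated by a constant multiple of \<open>h x\<close>: relative to the scale, \<open>g\<close>
  has a bounded number of places where it can send a foot.

  The heights are chosen so that no \<open>g\<close> can comply (\<open>heights_defeating_bilipschitz_maps\<close>). The
  points of the grid of mesh \<open>1 / P ^ j\<close> have hairs of length at least \<open>1 / (4 * P ^ j)\<close>, and in
  each cell of this grid one further point of the next grid, the mark, gets a hair of that length. If \<open>g\<close>
  is nearly affine on a cell, then its values at the ends of the cell leave only \<open>B\<close> possible places
  for the mark, where \<open>B\<close> does not depend on \<open>P\<close>. On a given segment there are at most \<open>B ^ N\<close> possible
  lists of values of \<open>g\<close> on the \<open>N + 1\<close> grid points, but there are \<open>(P / 2) ^ N\<close> systems of marks to choose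
  from; for \<open>P\<close> large compared with \<open>B\<close> and the number of segments, some system of marks is such that
  every list of values is compatible with near-affinity on at most half of the cells (\<open>marks_defeating_tuples\<close>). With these marks, passing
  from one grid to the next raises the energy, the sum of \<open>(increment of g)\<^sup>2 / mesh\<close> over the cells, by an
  amount independent of the level (\<open>energy_gain\<close>). But the energy never exceeds \<open>k\<^sup>2\<close>.

  Two finiteness facts make one comb suffice. By compactness \<open>U\<close> has finitely many branch points of
  height at least \<open>r\<close>, so only finitely many geodesic segments have to be dealt with at once; and the constants
  \<open>k = 1, 2, 3, \<dots>\<close> are dealt with on disjoint blocks of the base.
\<close>

section \<open>Separation by points of an arc\<close>

text \<open>If a connected set joined the ends of the arc while avoiding \<open>z\<close>, then so would a path and
  hence an arc \<open>q\<close>. Going along \<open>\<gamma>\<close> from \<open>z\<close> in both directions up to the first points on \<open>q\<close>,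
  and back along \<open>q\<close>, gives a simple closed curve.\<close>

lemma arc_point_separates:
  fixes S :: "'v::{complete_space,real_normed_vector} set"
  assumes lpc: "locally path_connected S"
    and no_loop: "\<And>\<gamma>. simple_path \<gamma> \<Longrightarrow> pathfinish \<gamma> = pathstart \<gamma> \<Longrightarrow> \<not> path_image \<gamma> \<subseteq> S"
    and \<gamma>: "arc \<gamma>" "path_image \<gamma> \<subseteq> S"
    and z: "z \<in> path_image \<gamma>" "z \<noteq> pathstart \<gamma>" "z \<noteq> pathfinish \<gamma>"
    and C: "connected C" "C \<subseteq> S" "pathstart \<gamma> \<in> C" "pathfinish \<gamma> \<in> C"
  shows "z \<in> C"
proof (rule ccontr)
  assume "z \<notin> C"
  have "openin (top_of_set S) (S - {z})"
    by (metis Diff_eq closed_singleton open_Compl openin_open_Int)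
  then have lpc': "locally path_connected (S - {z})"
    using lpc locally_open_subset by blast
  have "connected_component (S - {z}) (pathstart \<gamma>) (pathfinish \<gamma>)"
    unfolding connected_component_def using C \<open>z \<notin> C\<close> by blast
  then have "path_component (S - {z}) (pathstart \<gamma>) (pathfinish \<gamma>)"
    by (simp add: path_component_eq_connected_component[OF lpc'])
  then obtain p where p: "path p" "path_image p \<subseteq> S - {z}" "pathstart p = pathstart \<gamma>" "pathfinish p = pathfinish \<gamma>"
    unfolding path_component_def by blast
  have "pathstart \<gamma> \<noteq> pathfinish \<gamma>"
    using arc_distinct_ends[OF \<gamma>(1)] by auto
  then obtain q where q: "arc q" "path_image q \<subseteq> path_image p" "pathstart q = pathstart \<gamma>" "pathfinish q = pathfinish \<gamma>"
    by (rule path_contains_arc[OF p(1,3,4)])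
  have zq: "z \<notin> path_image q" using p q by blast
  obtain \<tau> where \<tau>: "\<tau> \<in> {0..1}" "\<gamma> \<tau> = z"
    using z(1) by (auto simp: path_image_def)
  have cont: "continuous_on {0..1} \<gamma>" using \<gamma>(1) by (simp add: arc_def path_def)
  have inj: "inj_on \<gamma> {0..1}" using \<gamma>(1) by (simp add: arc_def)
  \<comment> \<open>\<open>]s, t[\<close> will be the component of the complement of \<open>W\<close> that contains \<open>\<tau>\<close>.\<close>
  define W where "W = {t \<in> {0..1}. \<gamma> t \<in> path_image q}"
  have "closed W"
    unfolding W_def
    using continuous_closed_preimage[OF cont closed_atLeastAtMost closed_path_image[OF arc_imp_path[OF q(1)]]]
    by (simp add: vimage_def Int_def)
  have 01: "0 \<in> W" "1 \<in> W"
    unfolding W_def using q(3,4) pathstart_in_path_image[of q] pathfinish_in_path_image[of q]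
    by (auto simp: pathstart_def pathfinish_def)
  have \<tau>W: "\<tau> \<notin> W" using zq \<tau> by (auto simp: W_def)
  define A where "A = W \<inter> {0..\<tau>}"
  define B where "B = W \<inter> {\<tau>..1}"
  have "compact A" "compact B" unfolding A_def B_def
    using \<open>closed W\<close> by (auto intro: closed_Int_compact)
  moreover have "A \<noteq> {}" "B \<noteq> {}" using 01 \<tau> by (auto simp: A_def B_def)
  ultimately obtain s t where s: "s \<in> A" "\<And>r. r \<in> A \<Longrightarrow> r \<le> s" and t: "t \<in> B" "\<And>r. r \<in> B \<Longrightarrow> t \<le> r"
    using compact_attains_sup[of A] compact_attains_inf[of B] by auto
  have st: "0 \<le> s" "s < \<tau>" "\<tau> < t" "t \<le> 1" "s \<in> W" "t \<in> W"
    using s(1) t(1) \<tau>W unfolding A_def B_def by (auto simp: less_le)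
  have gap: "r = s \<or> r = t" if "r \<in> W" "s \<le> r" "r \<le> t" for r
    using that s(2)[of r] t(2)[of r] st by (force simp: A_def B_def)
  obtain u v where u: "u \<in> {0..1}" "q u = \<gamma> s" and v: "v \<in> {0..1}" "q v = \<gamma> t"
    using st(5,6) unfolding W_def path_image_def by (auto simp: image_iff)
  have "\<gamma> s \<noteq> \<gamma> t" using inj st by (simp add: inj_on_def) force
  then have "u \<noteq> v" using u v by auto
  have arcs: "arc (subpath s t \<gamma>)" "arc (subpath v u q)"
    using arc_subpath_arc[OF \<gamma>(1), of s t] arc_subpath_arc[OF q(1), of v u] u v st \<open>u \<noteq> v\<close> by auto
  have im1: "path_image (subpath s t \<gamma>) = \<gamma> ` {s..t}"
    using st by (simp add: path_image_subpath)
  have im2: "path_image (subpath v u q) \<subseteq> path_image q"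
    using u v by (simp add: path_image_subpath_subset)
  have ends: "pathfinish (subpath s t \<gamma>) = pathstart (subpath v u q)" "pathfinish (subpath v u q) = pathstart (subpath s t \<gamma>)"
    using u v by auto
  have "simple_path (subpath s t \<gamma> +++ subpath v u q)"
  proof (rule simple_path_join_loop[OF arcs ends])
    have "w = \<gamma> s \<or> w = \<gamma> t" if w: "w \<in> \<gamma> ` {s..t}" "w \<in> path_image q" for w
    proof -
      obtain r where "r \<in> {s..t}" "w = \<gamma> r" using w by blast
      then show ?thesis using w(2) st gap[of r] by (auto simp: W_def)
    qed
    then show "path_image (subpath s t \<gamma>) \<inter> path_image (subpath v u q)
        \<subseteq> {pathstart (subpath s t \<gamma>), pathstart (subpath v u q)}"
      unfolding im1 using im2 v by fastforce
  qed
  moreover have "path_image (subpath s t \<gamma> +++ subpath v u q) \<subseteq> S"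
  proof -
    have "\<gamma> ` {s..t} \<subseteq> S" using \<gamma>(2) st unfolding path_image_def by auto
    then show ?thesis
      using path_image_join_subset[of "subpath s t \<gamma>" "subpath v u q"] im1 im2 p q by blast
  qed
  ultimately show False
    using no_loop[of "subpath s t \<gamma> +++ subpath v u q"] ends by simp
qed

section \<open>Geodesics in abstract metric spaces\<close>

definition geodesic_from :: "'a metric \<Rightarrow> (real \<Rightarrow> 'a) \<Rightarrow> 'a \<Rightarrow> 'a \<Rightarrow> bool" where
  "geodesic_from M \<gamma> x y \<longleftrightarrow> \<gamma> 0 = x \<and> \<gamma> (mdist M x y) = y \<and>
     (\<forall>s\<in>{0..mdist M x y}. \<gamma> s \<in> mspace M) \<and>
     (\<forall>s\<in>{0..mdist M x y}. \<forall>t\<in>{0..mdist M x y}. mdist M (\<gamma> s) (\<gamma> t) = \<bar>s - t\<bar>)"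

definition geodesic_space :: "'a metric \<Rightarrow> bool" where
  "geodesic_space M \<longleftrightarrow> (\<forall>x\<in>mspace M. \<forall>y\<in>mspace M. \<exists>\<gamma>. geodesic_from M \<gamma> x y)"

lemma geodesic_join:
  assumes "geodesic_from M \<gamma> x z" "geodesic_from M \<delta> z y"
    and d: "mdist M x z + mdist M z y = mdist M x y"
  shows "geodesic_from M (\<lambda>t. if t \<le> mdist M x z then \<gamma> t else \<delta> (t - mdist M x z)) x y"
    (is "geodesic_from M ?\<gamma> x y")
proof -
  let ?a = "mdist M x z" let ?D = "mdist M x y"
  note g = assms(1,2)[unfolded geodesic_from_def]
  have nn: "0 \<le> ?a" "0 \<le> mdist M z y" by auto
  have xyz: "x \<in> mspace M" "y \<in> mspace M" "z \<in> mspace M"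
    using g nn by (metis atLeastAtMost_iff order_refl)+
  have in_space: "?\<gamma> t \<in> mspace M" if "t \<in> {0..?D}" for t
    using g that d by auto
  have eq: "mdist M (?\<gamma> s) (?\<gamma> t) = t - s" if "0 \<le> s" "s \<le> t" "t \<le> ?D" for s t
  proof (cases "t \<le> ?a \<or> ?a < s")
    case True
    then show ?thesis using that g d by auto
  next
    case False
    then have st: "s \<le> ?a" "?a < t" by auto
    have s: "?\<gamma> s = \<gamma> s" "mdist M x (\<gamma> s) = s" "mdist M (\<gamma> s) z = ?a - s" "\<gamma> s \<in> mspace M"
      using g that st by (auto; metis (no_types, opaque_lifting) abs_minus_commute abs_of_nonneg atLeastAtMost_iff diff_ge_0_iff_ge diff_zero nn(1) order_refl)+
    have t: "?\<gamma> t = \<delta> (t - ?a)" "mdist M z (\<delta> (t - ?a)) = t - ?a" "mdist M (\<delta> (t - ?a)) y = ?D - t"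
      "\<delta> (t - ?a) \<in> mspace M"
    proof -
      have "t - ?a \<in> {0..mdist M z y}" "0 \<in> {0..mdist M z y}" "mdist M z y \<in> {0..mdist M z y}" using that st d by auto
      then have "mdist M (\<delta> 0) (\<delta> (t - ?a)) = \<bar>0 - (t - ?a)\<bar>"
          "mdist M (\<delta> (t - ?a)) (\<delta> (mdist M z y)) = \<bar>(t - ?a) - mdist M z y\<bar>" "\<delta> (t - ?a) \<in> mspace M"
        using g by blast+
      then show "?\<gamma> t = \<delta> (t - ?a)" "mdist M z (\<delta> (t - ?a)) = t - ?a" "mdist M (\<delta> (t - ?a)) y = ?D - t"
      "\<delta> (t - ?a) \<in> mspace M"
        using g st that d by auto
    qed
    have "mdist M (\<gamma> s) (\<delta> (t - ?a)) \<le> t - s"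
      using mdist_triangle[OF s(4) xyz(3) t(4)] s t by linarith
    moreover have "?D \<le> s + mdist M (\<gamma> s) (\<delta> (t - ?a)) + (?D - t)"
      using mdist_triangle[OF xyz(1) s(4) xyz(2)] mdist_triangle[OF s(4) t(4) xyz(2)] s t by linarith
    ultimately show ?thesis using s t by simp
  qed
  have "mdist M (?\<gamma> s) (?\<gamma> t) = \<bar>s - t\<bar>" if "s \<in> {0..?D}" "t \<in> {0..?D}" for s t
    using eq[of s t] eq[of t s] that by (cases "s \<le> t") (auto simp: mdist_commute)
  moreover have "?\<gamma> ?D = y"
  proof (cases "?D \<le> ?a")
    case True
    then have "mdist M z y = 0" using d nn by linarith
    then have "z = y" "?a = ?D" using xyz d by auto
    then show ?thesis using g by auto
  next
    case False
    have "?D - ?a = mdist M z y" using d by simp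
    then show ?thesis using g False by simp
  qed
  ultimately show ?thesis
    unfolding geodesic_from_def using in_space g nn by auto
qed

lemma geodesic_through:
  assumes "geodesic_space M" "x \<in> mspace M" "y \<in> mspace M" "z \<in> mspace M"
    and "mdist M x z + mdist M z y = mdist M x y"
  obtains \<gamma> where "geodesic_from M \<gamma> x y" "\<gamma> (mdist M x z) = z"
proof -
  obtain \<gamma>1 \<gamma>2 where *: "geodesic_from M \<gamma>1 x z" "geodesic_from M \<gamma>2 z y"
    using assms(1-4) unfolding geodesic_space_def by meson
  from geodesic_join[OF this assms(5)] show thesis
    by (rule that) (use * in \<open>auto simp: geodesic_from_def\<close>)
qed

lemma geodesic_from_reverse:
  assumes "geodesic_from M \<gamma> x y"
  shows "geodesic_from M (\<lambda>t. \<gamma> (mdist M x y - t)) y x"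
  using assms unfolding geodesic_from_def by (auto simp: mdist_commute[of M y x])

text \<open>An isometry of the arc onto \<open>[0, d x y]\<close> takes \<open>x\<close> and \<open>y\<close> to numbers at distance \<open>d x y\<close>, that
  is to the two ends of the interval; up to reversal its inverse is the geodesic.\<close>

lemma geodesic_tree_imp_geodesic_space:
  assumes "geodesic_tree T"
  shows "geodesic_space T"
  unfolding geodesic_space_def
proof (intro ballI)
  fix x y assume xy: "x \<in> mspace T" "y \<in> mspace T"
  show "\<exists>\<gamma>. geodesic_from T \<gamma> x y"
  proof (cases "x = y")
    case True
    then show ?thesis using xy mdist_zero[of y T y] by (intro exI[of _ "\<lambda>_. x"]) (auto simp: geodesic_from_def simp del: mdist_zero)
  next
    case False
    let ?D = "mdist T x y"
    obtain A where A: "arc_between (mtopology_of T) x y A"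
      "isometric_spaces (submetric T A) (submetric euclidean_metric {0..?D})"
      using assms False xy unfolding geodesic_tree_def by blast
    obtain g where g: "embedding_map (top_of_set {0..1::real}) (mtopology_of T) g" "g 0 = x" "g 1 = y" "A = g ` {0..1}"
      using A(1) unfolding arc_between_def by blast
    have "g ` {0..1} \<subseteq> mspace T"
      using g(1) homeomorphic_imp_continuous_map[of "top_of_set {0..1::real}"] unfolding embedding_map_def
      by (force simp: continuous_map_def Pi_iff)
    then have AT: "A \<subseteq> mspace T" "x \<in> A" "y \<in> A" using g by auto
    obtain f where f: "f ` A = {0..?D}" "\<And>u v. u \<in> A \<Longrightarrow> v \<in> A \<Longrightarrow> dist (f u) (f v) = mdist T u v"
      using A(2) AT unfolding isometric_spaces_def by (auto simp: Int_absorb2)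
    have inj: "inj_on f A"
      using f(2) AT by (metis dist_self inj_onI mdist_zero subset_eq)
    define h where "h = the_inv_into A f"
    have h: "h s \<in> A" "f (h s) = s" if "s \<in> {0..?D}" for s
      using that inj f(1) unfolding h_def
      by (metis the_inv_into_into order_refl, metis f_the_inv_into_f)
    have hf: "h (f u) = u" if "u \<in> A" for u
      using that inj unfolding h_def by (simp add: the_inv_into_f_f)
    have iso: "mdist T (h s) (h t) = \<bar>s - t\<bar>" if "s \<in> {0..?D}" "t \<in> {0..?D}" for s t
      using h that f(2)[of "h s" "h t"] by (auto simp: dist_real_def)
    have "\<bar>f x - f y\<bar> = ?D" "f x \<in> {0..?D}" "f y \<in> {0..?D}"
      using f AT by (auto simp: dist_real_def)
    then consider "f x = 0" "f y = ?D" | "f y = 0" "f x = ?D" by (auto simp: abs_if split: if_splits)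
    then show ?thesis
    proof cases
      case 1
      then have "geodesic_from T h x y"
        unfolding geodesic_from_def using h hf iso AT by (metis in_mono)
      then show ?thesis by blast
    next
      case 2
      then have "geodesic_from T h y x"
        unfolding geodesic_from_def using h hf iso AT by (metis in_mono mdist_commute)
      then show ?thesis using geodesic_from_reverse[of T h y x] by blast
    qed
  qed
qed

lemma continuous_map_geodesic:
  assumes "geodesic_from M \<gamma> x y"
  shows "continuous_map (top_of_set {0..mdist M x y}) (mtopology_of M) \<gamma>"
proof -
  have "Lipschitz_continuous_map (submetric euclidean_metric {0..mdist M x y}) M \<gamma>"
    unfolding Lipschitz_continuous_map_def using assms
    by (auto simp: geodesic_from_def dist_real_def intro!: exI[of _ 1])
  then show ?thesis
    using Lipschitz_continuous_imp_continuous_map[of "submetric euclidean_metric {0..mdist M x y}" M \<gamma>]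
    by (simp add: mtopology_of_submetric)
qed

lemma geodesic_from_pathin:
  assumes "geodesic_from M \<gamma> x y"
  shows "pathin (mtopology_of M) (\<lambda>t. \<gamma> (mdist M x y * t))"
proof -
  have "continuous_map (top_of_set {0..1}) (top_of_set {0..mdist M x y}) (\<lambda>t. mdist M x y * t)"
    by (auto simp: continuous_map_in_subtopology mult_left_le intro!: continuous_intros)
  from continuous_map_compose[OF this continuous_map_geodesic[OF assms]]
  show ?thesis unfolding pathin_def by (simp add: o_def)
qed

text \<open>A geodesic issuing from the centre of a ball stays in the ball.\<close>

lemma geodesic_space_locally_path_connected:
  assumes "geodesic_space M"
  shows "locally_path_connected_space (mtopology_of M)"
proof -
  interpret Metric_space "mspace M" "mdist M" by simp
  have "\<exists>U. openin mtopology U \<and> path_connectedin mtopology U \<and> x \<in> U \<and> U \<subseteq> V"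
    if V: "openin mtopology V" "x \<in> V" for V x
  proof -
    obtain r where r: "r > 0" "mball x r \<subseteq> V" and x: "x \<in> mspace M"
      using V unfolding openin_mtopology by blast
    have "path_component_of (subtopology mtopology (mball x r)) x y" if "y \<in> mball x r" for y
    proof -
      from that have y: "y \<in> mspace M" "mdist M x y < r" by auto
      then obtain \<gamma> where \<gamma>: "geodesic_from M \<gamma> x y"
        using assms x unfolding geodesic_space_def by blast
      have "\<gamma> (mdist M x y * t) \<in> mball x r" if "t \<in> {0..1}" for t
      proof -
        have "mdist M x y * t \<le> mdist M x y * 1" using that by (intro mult_left_mono) auto
        then have *: "mdist M x y * t \<in> {0..mdist M x y}" "0 \<in> {0..mdist M x y}" using that by auto
        then have "mdist M (\<gamma> 0) (\<gamma> (mdist M x y * t)) = \<bar>0 - mdist M x y * t\<bar>" "\<gamma> (mdist M x y * t) \<in> mspace M"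
          using \<gamma> unfolding geodesic_from_def by blast+
        then show ?thesis using \<gamma> * y x by (auto simp: geodesic_from_def)
      qed
      then have "pathin (subtopology mtopology (mball x r)) (\<lambda>t. \<gamma> (mdist M x y * t))"
        using geodesic_from_pathin[OF \<gamma>] by (auto simp: pathin_subtopology mtopology_of_def)
      moreover have "\<gamma> 0 = x" "\<gamma> (mdist M x y) = y" using \<gamma> by (auto simp: geodesic_from_def)
      ultimately show ?thesis unfolding path_component_of_def
        by (intro exI[of _ "\<lambda>t. \<gamma> (mdist M x y * t)"]) auto
    qed
    then have "path_connectedin mtopology (mball x r)"
      unfolding path_connectedin_def path_connected_space_iff_path_component
      by (auto; meson path_component_of_sym path_component_of_trans in_mball)
    then show ?thesis using r x by (intro exI[of _ "mball x r"]) auto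
  qed
  then show ?thesis
    unfolding locally_path_connected_space mtopology_of_def by blast
qed

lemma geodesic_space_connected:
  assumes "geodesic_space M"
  shows "connected_space (mtopology_of M)"
proof -
  have "path_connected_space (mtopology_of M)"
    unfolding path_connected_space_def topspace_mtopology_of
  proof (intro ballI)
    fix x y assume "x \<in> mspace M" "y \<in> mspace M"
    then obtain \<gamma> where \<gamma>: "geodesic_from M \<gamma> x y"
      using assms unfolding geodesic_space_def by blast
    then show "\<exists>g. pathin (mtopology_of M) g \<and> g 0 = x \<and> g 1 = y"
      using geodesic_from_pathin[OF \<gamma>] by (intro exI[of _ "\<lambda>t. \<gamma> (mdist M x y * t)"]) (auto simp: geodesic_from_def)
  qed
  then show ?thesis by (rule path_connected_imp_connected_space)
qed

section \<open>Points of a geodesic separate a geodesic tree\<close>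

lemma compact_metric_bounded:
  assumes "compact_space (mtopology_of M)"
  shows "\<exists>b. \<forall>x\<in>mspace M. \<forall>y\<in>mspace M. mdist M x y \<le> b"
proof -
  interpret Metric_space "mspace M" "mdist M" by simp
  have "mbounded (mspace M)"
    using assms compactin_imp_mbounded[of "mspace M"] unfolding compact_space_def mtopology_of_def by simp
  then show ?thesis unfolding mbounded_alt by blast
qed

text \<open>The map \<open>x \<mapsto> d x\<close> into the bounded functions. Through it the results on paths in
  Banach spaces, above all that a path contains an arc, become available in a metric space that is
  given by a carrier. The discrete topology on the points makes every bounded function continuous.\<close>

lemma kuratowski_embedding:
  assumes "compact_space (mtopology_of M)"
  shows "\<exists>e :: 'a \<Rightarrow> ('a discrete \<Rightarrow>\<^sub>C real). \<forall>x\<in>mspace M. \<forall>y\<in>mspace M. dist (e x) (e y) = mdist M x y"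
proof -
  obtain b where b: "\<And>x y. x \<in> mspace M \<Longrightarrow> y \<in> mspace M \<Longrightarrow> mdist M x y \<le> b"
    using compact_metric_bounded[OF assms] by blast
  define \<phi> where "\<phi> x z = (if of_discrete z \<in> mspace M then mdist M x (of_discrete z) else 0)" for x and z :: "'a discrete"
  define e where "e x = Bcontfun (\<phi> x)" for x
  have e: "apply_bcontfun (e x) = \<phi> x" if x: "x \<in> mspace M" for x
  proof -
    have "\<phi> x \<in> bcontfun"
      unfolding bcontfun_def
    proof (intro CollectI conjI)
      show "continuous_on UNIV (\<phi> x)"
        by (simp add: continuous_on_open_vimage open_discrete)
      show "bounded (range (\<phi> x))"
        unfolding bounded_iff using b[OF x] by (intro exI[of _ "\<bar>b\<bar>"]) (force simp: \<phi>_def)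
    qed
    then show ?thesis unfolding e_def by (rule Bcontfun_inverse)
  qed
  have "dist (e x) (e y) = mdist M x y" if xy: "x \<in> mspace M" "y \<in> mspace M" for x y
  proof (rule antisym)
    show "dist (e x) (e y) \<le> mdist M x y"
    proof (rule dist_bound)
      fix z
      show "dist (e x z) (e y z) \<le> mdist M x y"
        using xy mdist_triangle[of x M y "of_discrete z"] mdist_triangle[of y M x "of_discrete z"]
        by (auto simp: e \<phi>_def dist_real_def mdist_commute)
    qed
    have "dist (e x (discrete y)) (e y (discrete y)) \<le> dist (e x) (e y)" by (rule dist_bounded)
    moreover have "mdist M y y = 0" using xy by simp
    ultimately show "mdist M x y \<le> dist (e x) (e y)"
      using xy by (simp add: e \<phi>_def discrete_inverse dist_real_def)
  qed
  then show ?thesis by blast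
qed

lemma locally_path_connected_top_of_set:
  assumes "locally_path_connected_space (top_of_set S)"
  shows "locally path_connected S"
proof -
  have "path_connected U" if "path_connectedin (top_of_set S) U" for U
    using that unfolding path_connectedin_subtopology
    by (auto simp: path_connectedin_def path_connected_space_def path_connected_def pathin_subtopology
        path_def pathin_def path_image_def pathstart_def pathfinish_def) blast
  then show ?thesis
    using assms unfolding locally_path_connected_space locally_def by (meson subset_refl)
qed

lemma homeomorphic_imp_homeomorphic_space:
  assumes "S homeomorphic T"
  shows "top_of_set S homeomorphic_space top_of_set T"
proof -
  obtain f g where "homeomorphism S T f g" using assms unfolding homeomorphic_def by blast
  then have "homeomorphic_maps (top_of_set S) (top_of_set T) f g"
    unfolding homeomorphism_def homeomorphic_maps_def by (auto simp: continuous_map_in_subtopology)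
  then show ?thesis unfolding homeomorphic_space_def by blast
qed

text \<open>The key property of trees. It is \<open>arc_point_separates\<close> for a geodesic through \<open>z\<close>,
  transported to a Banach space, where circles are images of simple closed paths.\<close>

lemma geodesic_tree_separation:
  assumes U: "geodesic_tree U"
    and xyz: "x \<in> mspace U" "y \<in> mspace U" "z \<in> mspace U"
    and between: "mdist U x z + mdist U z y = mdist U x y"
    and C: "connectedin (mtopology_of U) C" "x \<in> C" "y \<in> C"
  shows "z \<in> C"
proof (cases "z = x \<or> z = y")
  case False
  have geo: "geodesic_space U" by (rule geodesic_tree_imp_geodesic_space[OF U])
  have "metric_tree U" using U by (simp add: geodesic_tree_def)
  then have comp: "compact_space (mtopology_of U)" and noS: "\<And>S. \<not> simple_closed_curve_in (mtopology_of U) S"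
    unfolding metric_tree_def by auto
  obtain e :: "'a \<Rightarrow> ('a discrete \<Rightarrow>\<^sub>C real)" where
    e: "\<And>x y. x \<in> mspace U \<Longrightarrow> y \<in> mspace U \<Longrightarrow> dist (e x) (e y) = mdist U x y"
    using kuratowski_embedding[OF comp] by blast
  define S where "S = e ` mspace U"
  have inj: "inj_on e (mspace U)"
    using e by (metis dist_self inj_onI mdist_zero)
  have "continuous_map (mtopology_of U) (mtopology_of euclidean_metric) e"
    by (rule Lipschitz_continuous_imp_continuous_map)
      (auto simp: Lipschitz_continuous_map_def e intro!: exI[of _ 1])
  then have conte: "continuous_map (mtopology_of U) (top_of_set S) e"
    by (auto simp: continuous_map_in_subtopology S_def)
  have hom: "homeomorphic_map (mtopology_of U) (top_of_set S) e"
    by (rule continuous_imp_homeomorphic_map[OF conte comp])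
      (use inj in \<open>auto simp: S_def intro: Hausdorff_space_subtopology\<close>)
  have lpc: "locally path_connected S"
    using geodesic_space_locally_path_connected[OF geo] 
      homeomorphic_locally_path_connected_space[OF homeomorphic_map_imp_homeomorphic_space[OF hom]]
    by (simp add: locally_path_connected_top_of_set)
  have no_loop: "\<not> path_image \<gamma> \<subseteq> S" if "simple_path \<gamma>" "pathfinish \<gamma> = pathstart \<gamma>" for \<gamma>
  proof
    assume sub: "path_image \<gamma> \<subseteq> S"
    define A where "A = {u \<in> mspace U. e u \<in> path_image \<gamma>}"
    have "A \<subseteq> topspace (mtopology_of U)" by (auto simp: A_def)
    moreover have "e ` A = path_image \<gamma>" using sub by (auto simp: A_def S_def)
    ultimately have "homeomorphic_map (subtopology (mtopology_of U) A) (subtopology (top_of_set S) (path_image \<gamma>)) e"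
      using homeomorphic_map_subtopologies[OF hom, of A "path_image \<gamma>"] sub
      by (auto simp: A_def S_def)
    then have "subtopology (mtopology_of U) A homeomorphic_space top_of_set (path_image \<gamma>)"
      using sub homeomorphic_map_imp_homeomorphic_space
      by (metis inf.absorb_iff2 subtopology_subtopology)
    moreover have "top_of_set (path_image \<gamma>) homeomorphic_space top_of_set (sphere (0::complex) 1)"
      using homeomorphic_simple_path_image_circle[OF that, of 1 0] by (simp add: homeomorphic_imp_homeomorphic_space)
    ultimately have "simple_closed_curve_in (mtopology_of U) A"
      unfolding simple_closed_curve_in_def using homeomorphic_space_trans by (auto simp: A_def)
    then show False using noS by blast
  qed
  obtain \<gamma> where \<gamma>: "geodesic_from U \<gamma> x y" "\<gamma> (mdist U x z) = z"
    by (rule geodesic_through[OF geo xyz between])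
  let ?D = "mdist U x y"
  define \<delta> where "\<delta> = e \<circ> (\<lambda>t. \<gamma> (?D * t))"
  have D: "?D > 0" using False between xyz mdist_nonneg[of U z y] mdist_nonneg[of U x z]
    by (metis add_nonneg_eq_0_iff less_eq_real_def mdist_nonneg mdist_zero)
  have D01: "?D * t \<in> {0..?D}" if "t \<in> {0..1}" for t
    using that D by (auto simp: mult_left_le)
  have path: "path \<delta>" "path_image \<delta> \<subseteq> S"
  proof -
    have "continuous_map (top_of_set {0..1}) (top_of_set S) \<delta>"
      using continuous_map_compose[OF geodesic_from_pathin[OF \<gamma>(1), unfolded pathin_def] conte]
      by (simp add: \<delta>_def)
    then show "path \<delta>" "path_image \<delta> \<subseteq> S"
      by (auto simp: path_def path_image_def)
  qed
  have "inj_on \<delta> {0..1}"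
  proof (rule inj_onI)
    fix s t assume st: "s \<in> {0..1}" "t \<in> {0..1}" "\<delta> s = \<delta> t"
    have "\<gamma> (?D * s) \<in> mspace U" "\<gamma> (?D * t) \<in> mspace U"
      "mdist U (\<gamma> (?D * s)) (\<gamma> (?D * t)) = \<bar>?D * s - ?D * t\<bar>"
      using \<gamma>(1) D01[OF st(1)] D01[OF st(2)] unfolding geodesic_from_def by blast+
    moreover have "e (\<gamma> (?D * s)) = e (\<gamma> (?D * t))" using st(3) by (simp add: \<delta>_def)
    ultimately have "\<bar>?D * s - ?D * t\<bar> = 0" using e by (metis dist_self)
    then have "?D * s = ?D * t" by simp
    then show "s = t" using D by simp
  qed
  then have arc: "arc \<delta>" using path by (simp add: arc_def)
  have ends: "pathstart \<delta> = e x" "pathfinish \<delta> = e y"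
    using \<gamma>(1) by (auto simp: \<delta>_def pathstart_def pathfinish_def geodesic_from_def)
  have "mdist U x z \<le> ?D" using between mdist_nonneg[of U z y] by linarith
  then have "mdist U x z / ?D \<in> {0..1}" using D by auto
  moreover have "\<delta> (mdist U x z / ?D) = e z" using \<gamma>(2) D by (simp add: \<delta>_def)
  ultimately have "e z \<in> path_image \<delta>" unfolding path_image_def by (metis imageI)
  moreover have "e z \<noteq> e x" "e z \<noteq> e y" using False inj xyz by (auto simp: inj_on_def)
  moreover have "connected (e ` C)"
    using connectedin_continuous_map_image[OF conte C(1)] by (simp add: connectedin_subtopology)
  moreover have "e ` C \<subseteq> S" using connectedin_subset_topspace[OF C(1)] by (auto simp: S_def)
  ultimately have "e z \<in> e ` C"
    using arc_point_separates[OF lpc no_loop arc path(2), of "e z" "e ` C"] C(2,3) ends by auto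
  then show ?thesis
    using inj xyz connectedin_subset_topspace[OF C(1)] by (auto simp: inj_on_def)
qed (use C in auto)

lemma geodesic_from_dist:
  assumes "geodesic_from M \<gamma> x y" "t \<in> {0..mdist M x y}"
  shows "mdist M x (\<gamma> t) = t" "mdist M (\<gamma> t) y = mdist M x y - t" "\<gamma> t \<in> mspace M"
proof -
  let ?D = "mdist M x y"
  have "0 \<in> {0..?D}" "?D \<in> {0..?D}" by auto
  then have "mdist M (\<gamma> 0) (\<gamma> t) = \<bar>0 - t\<bar>" "mdist M (\<gamma> t) (\<gamma> ?D) = \<bar>t - ?D\<bar>" "\<gamma> t \<in> mspace M"
    using assms unfolding geodesic_from_def by blast+
  then show "mdist M x (\<gamma> t) = t" "mdist M (\<gamma> t) y = ?D - t" "\<gamma> t \<in> mspace M"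
    using assms unfolding geodesic_from_def by auto
qed

text \<open>All points of the geodesic from \<open>g s\<close> to \<open>g t\<close> lie on the path, by separation. The parts of the
  geodesic on the path before \<open>u\<close> and after \<open>u\<close> are closed, so by connectedness they
  meet, and injectivity leaves \<open>g u\<close> as the only meeting point.\<close>

lemma geodesic_tree_injective_path_between:
  fixes a b :: real
  assumes U: "geodesic_tree U"
    and g: "continuous_map (top_of_set {a..b}) (mtopology_of U) g" "inj_on g {a..b}"
    and sut: "a \<le> s" "s \<le> u" "u \<le> t" "t \<le> b"
  shows "mdist U (g s) (g u) + mdist U (g u) (g t) = mdist U (g s) (g t)"
proof -
  have gU: "g r \<in> mspace U" if "r \<in> {a..b}" for r
    using g(1) that by (auto simp: continuous_map_def)
  have sub: "continuous_map (top_of_set I) (mtopology_of U) g" if "I \<subseteq> {a..b}" for I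
    using continuous_map_from_subtopology_mono[OF g(1) that] .
  obtain \<gamma> where \<gamma>: "geodesic_from U \<gamma> (g s) (g t)"
  proof -
    have "s \<in> {a..b}" "t \<in> {a..b}" using sut by auto
    then have "g s \<in> mspace U" "g t \<in> mspace U" using gU by blast+
    then show ?thesis
      using that geodesic_tree_imp_geodesic_space[OF U] unfolding geodesic_space_def by blast
  qed
  let ?D = "mdist U (g s) (g t)"
  have Hausdorff: "Hausdorff_space (mtopology_of U)"
    by (simp add: Metric_space.Hausdorff_space_mtopology mtopology_of_def)
  have closed: "closedin (mtopology_of U) (g ` {c..d})" if "a \<le> c" "d \<le> b" for c d
  proof (rule compactin_imp_closedin[OF Hausdorff])
    have "compactin (top_of_set {c..d}) {c..d}" by (simp add: compactin_subtopology)
    then show "compactin (mtopology_of U) (g ` {c..d})"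
      using image_compactin sub[of "{c..d}"] that by fastforce
  qed
  have conn: "connectedin (mtopology_of U) (g ` {s..t})"
  proof -
    have "connectedin (top_of_set {s..t}) {s..t}" by (simp add: connectedin_subtopology)
    then show ?thesis using connectedin_continuous_map_image sub[of "{s..t}"] sut by fastforce
  qed
  have on_path: "\<gamma> \<tau> \<in> g ` {s..t}" if "\<tau> \<in> {0..?D}" for \<tau>
    using geodesic_tree_separation[OF U gU[of s] gU[of t] geodesic_from_dist(3)[OF \<gamma> that] _ conn]
      geodesic_from_dist[OF \<gamma> that] sut by auto
  define A where "A = {\<tau> \<in> {0..?D}. \<gamma> \<tau> \<in> g ` {s..u}}"
  define B where "B = {\<tau> \<in> {0..?D}. \<gamma> \<tau> \<in> g ` {u..t}}"
  have "closedin (top_of_set {0..?D}) A" "closedin (top_of_set {0..?D}) B"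
    using closedin_continuous_map_preimage[OF continuous_map_geodesic[OF \<gamma>] closed[of s u]]
      closedin_continuous_map_preimage[OF continuous_map_geodesic[OF \<gamma>] closed[of u t]] sut
    unfolding A_def B_def by auto
  moreover have "{0..?D} \<subseteq> A \<union> B"
  proof
    fix \<tau> assume \<tau>: "\<tau> \<in> {0..?D}"
    then obtain r where "r \<in> {s..t}" "\<gamma> \<tau> = g r" using on_path by blast
    then show "\<tau> \<in> A \<union> B" using \<tau> unfolding A_def B_def by (cases "r \<le> u") auto
  qed
  moreover have "0 \<in> A" "?D \<in> B"
    using \<gamma> sut unfolding A_def B_def geodesic_from_def by auto
  moreover have "connected {0..?D}" by simp
  ultimately obtain \<tau> where "\<tau> \<in> A" "\<tau> \<in> B"
    unfolding connected_closedin by blast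
  then obtain r r' where r: "r \<in> {s..u}" "r' \<in> {u..t}" "\<gamma> \<tau> = g r" "\<gamma> \<tau> = g r'" and \<tau>: "\<tau> \<in> {0..?D}"
    unfolding A_def B_def by blast
  have "r = r'" using r g(2) sut by (auto simp: inj_on_def)
  then have "\<gamma> \<tau> = g u" using r by auto
  then show ?thesis using geodesic_from_dist[OF \<gamma> \<tau>] by simp
qed

text \<open>By separation \<open>p\<close> lies on the geodesic from \<open>x\<close> to \<open>y\<close> through \<open>q\<close>: there is only one segment
  between two points, and distances on it are differences of positions.\<close>

lemma geodesic_tree_between_dist:
  assumes U: "geodesic_tree U"
    and "x \<in> mspace U" "y \<in> mspace U" "p \<in> mspace U" "q \<in> mspace U"
    and p: "mdist U x p + mdist U p y = mdist U x y"
    and q: "mdist U x q + mdist U q y = mdist U x y"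
  shows "mdist U p q = \<bar>mdist U x p - mdist U x q\<bar>"
proof -
  obtain \<gamma> where \<gamma>: "geodesic_from U \<gamma> x y" "\<gamma> (mdist U x q) = q"
    by (rule geodesic_through[OF geodesic_tree_imp_geodesic_space[OF U] _ _ _ q]) (use assms in auto)
  let ?D = "mdist U x y"
  have "connectedin (mtopology_of U) (\<gamma> ` {0..?D})"
    using connectedin_continuous_map_image[OF continuous_map_geodesic[OF \<gamma>(1)], of "{0..?D}"]
    by (simp add: connectedin_subtopology)
  moreover have "x \<in> \<gamma> ` {0..?D}" "y \<in> \<gamma> ` {0..?D}"
    using \<gamma>(1) by (auto simp: geodesic_from_def image_iff intro: bexI[of _ 0] bexI[of _ ?D])
  ultimately have "p \<in> \<gamma> ` {0..?D}"
    using geodesic_tree_separation[OF U _ _ _ p] assms by blast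
  then obtain s where s: "s \<in> {0..?D}" "p = \<gamma> s" by blast
  have "mdist U x q \<in> {0..?D}"
    using q mdist_nonneg[of U q y] mdist_nonneg[of U x q] unfolding atLeastAtMost_iff by linarith
  then have "mdist U (\<gamma> s) (\<gamma> (mdist U x q)) = \<bar>s - mdist U x q\<bar>"
    using \<gamma>(1) s unfolding geodesic_from_def by blast
  then show ?thesis using s \<gamma> geodesic_from_dist(1)[OF \<gamma>(1) s(1)] by simp
qed

lemma geodesic_tree_distinct_branches:
  assumes U: "geodesic_tree U"
    and C: "C \<in> branches U q" "D \<in> branches U q" "x \<in> C" "y \<in> D"
    and q: "q \<in> mspace U" "mdist U x q + mdist U q y = mdist U x y"
  shows "C \<noteq> D"
proof
  assume "C = D"
  let ?X = "subtopology (mtopology_of U) (mspace U - {q})"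
  have "connectedin ?X C" using C(1) unfolding branches_def by (rule connectedin_connected_components_of)
  then have "connectedin (mtopology_of U) C" "C \<subseteq> mspace U - {q}"
    by (auto simp: connectedin_subtopology)
  then show False
    using geodesic_tree_separation[OF U _ _ q] C \<open>C = D\<close> by blast
qed

section \<open>Branches and heights\<close>

lemma mdist_le_mdiam:
  assumes "compact_space (mtopology_of M)" "S \<subseteq> mspace M" "x \<in> S" "y \<in> S"
  shows "mdist M x y \<le> mdiam M S"
proof -
  obtain b where "\<forall>x\<in>mspace M. \<forall>y\<in>mspace M. mdist M x y \<le> b"
    using compact_metric_bounded[OF assms(1)] by blast
  then have "bdd_above ((\<lambda>(x, y). mdist M x y) ` (S \<times> S))"
    using assms(2) by (intro bdd_aboveI[of _ b]) auto
  then show ?thesis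
    unfolding mdiam_def using assms(3,4) cSUP_upper[of "(x, y)" "S \<times> S" "\<lambda>(x, y). mdist M x y"] by auto
qed

lemma branch_enumeration_exists:
  assumes "finite (branches T p)"
  shows "\<exists>B. branch_enumeration T p B"
proof -
  obtain ys where ys: "set ys = branches T p" "distinct ys"
    using finite_distinct_list[OF assms] by blast
  define xs where "xs = sort_key (\<lambda>B. - mdiam T B) ys"
  have xs: "set xs = branches T p" "distinct xs" "sorted (map (\<lambda>B. - mdiam T B) xs)"
    using ys by (auto simp: xs_def)
  have len: "length xs = card (branches T p)" using xs distinct_card by metis
  define B where "B i = xs ! (i - 1)" for i
  have I: "{i. 1 \<le> i \<and> enat i \<le> valence T p} = Suc ` {..<length xs}"
    using assms len by (auto simp: valence_def image_iff Suc_le_eq gr0_conv_Suc)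
  have "bij_betw B (Suc ` {..<length xs}) (branches T p)"
    using bij_betw_nth[OF xs(2) refl, of "branches T p"] xs(1) 
    by (auto simp: bij_betw_def B_def inj_on_def image_image)
  moreover have "mdiam T (B j) \<le> mdiam T (B i)" if "i \<in> Suc ` {..<length xs}" "j \<in> Suc ` {..<length xs}" "i \<le> j" for i j
    using that xs(3) sorted_nth_mono[OF xs(3), of "i - 1" "j - 1"] by (auto simp: B_def)
  ultimately have "branch_enumeration T p B"
    unfolding branch_enumeration_def Let_def I by blast
  then show ?thesis by blast
qed

lemma height_enumeration:
  assumes "finite (branches T p)"
  obtains B where "bij_betw B {1..card (branches T p)} (branches T p)"
    "\<And>i j. 1 \<le> i \<Longrightarrow> i \<le> j \<Longrightarrow> j \<le> card (branches T p) \<Longrightarrow> mdiam T (B j) \<le> mdiam T (B i)"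
    "height T p = mdiam T (B 3)"
proof -
  define B where "B = (SOME B. branch_enumeration T p B)"
  have "branch_enumeration T p B"
    unfolding B_def by (rule someI_ex[OF branch_enumeration_exists[OF assms]])
  moreover have I: "{i. 1 \<le> i \<and> enat i \<le> valence T p} = {1..card (branches T p)}"
    using assms by (auto simp: valence_def)
  ultimately have "bij_betw B {1..card (branches T p)} (branches T p)"
    "\<forall>i\<in>{1..card (branches T p)}. \<forall>j\<in>{1..card (branches T p)}. i \<le> j \<longrightarrow> mdiam T (B j) \<le> mdiam T (B i)"
    unfolding branch_enumeration_def Let_def I by blast+
  moreover have "height T p = mdiam T (B 3)" by (simp add: height_def B_def)
  ultimately show ?thesis
    by (intro that[of B]) auto
qed

text \<open>Only two members of \<open>\<C>\<close> can come before the third place of the enumeration.\<close>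

lemma height_ge:
  assumes fin: "finite (branches T p)"
    and C: "\<C> \<subseteq> branches T p" "card \<C> = 3" "\<And>C. C \<in> \<C> \<Longrightarrow> \<rho> \<le> mdiam T C"
  shows "valence T p \<ge> 3" "height T p \<ge> \<rho>"
proof -
  have 3: "3 \<le> card (branches T p)" using card_mono[OF fin C(1)] C(2) by simp
  then show "valence T p \<ge> 3"
    using fin by (simp add: valence_def numeral_eq_enat)
  obtain B where B: "bij_betw B {1..card (branches T p)} (branches T p)"
    "\<And>i j. 1 \<le> i \<Longrightarrow> i \<le> j \<Longrightarrow> j \<le> card (branches T p) \<Longrightarrow> mdiam T (B j) \<le> mdiam T (B i)"
    "height T p = mdiam T (B 3)"
    using height_enumeration[OF fin] by blast
  have "\<not> \<C> \<subseteq> B ` {1..2}"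
  proof
    assume "\<C> \<subseteq> B ` {1..2}"
    then have "card \<C> \<le> card {1..2::nat}"
      by (meson card_image_le card_mono finite_atLeastAtMost finite_imageI order_trans)
    then show False using C(2) by simp
  qed
  then obtain C' where C': "C' \<in> \<C>" "C' \<notin> B ` {1..2}" by blast
  then obtain i where i: "i \<in> {1..card (branches T p)}" "C' = B i"
    using B(1) C(1) unfolding bij_betw_def by blast
  then have "3 \<le> i" using C' by (cases "i \<le> 2") auto
  then show "height T p \<ge> \<rho>" using B(2)[of 3 i] B(3) i C(3)[OF C'(1)] by simp
qed

lemma height_le:
  assumes fin: "finite (branches T p)" and C: "card (branches T p) = 3" "C \<in> branches T p"
  shows "height T p \<le> mdiam T C"
proof -
  obtain B where B: "bij_betw B {1..card (branches T p)} (branches T p)"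
    "\<And>i j. 1 \<le> i \<Longrightarrow> i \<le> j \<Longrightarrow> j \<le> card (branches T p) \<Longrightarrow> mdiam T (B j) \<le> mdiam T (B i)"
    "height T p = mdiam T (B 3)"
    using height_enumeration[OF fin] by blast
  then obtain i where i: "i \<in> {1..card (branches T p)}" "C = B i"
    using C unfolding bij_betw_def by blast
  then show ?thesis using B(2)[of i 3] B(3) C(1) by auto
qed

section \<open>Recognising trees and their branches\<close>

lemma geodesic_treeI:
  assumes ne: "mspace T \<noteq> {}" and comp: "compact_space (mtopology_of T)" and geo: "geodesic_space T"
    and no_loop: "\<And>S. \<not> simple_closed_curve_in (mtopology_of T) S"
  shows "geodesic_tree T"
  unfolding geodesic_tree_def
proof (intro conjI ballI impI)
  show "metric_tree T"
    unfolding metric_tree_def using ne comp no_loop geodesic_space_connected[OF geo]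
      locally_path_connected_imp_locally_connected_space[OF geodesic_space_locally_path_connected[OF geo]] by blast
  fix x y assume xy: "x \<in> mspace T" "y \<in> mspace T" "x \<noteq> y"
  let ?D = "mdist T x y"
  have D: "?D > 0" using xy by (metis less_eq_real_def mdist_nonneg mdist_zero)
  obtain \<gamma> where \<gamma>: "geodesic_from T \<gamma> x y" using geo xy unfolding geodesic_space_def by blast
  define A where "A = \<gamma> ` {0..?D}"
  have iso: "\<And>s t. s \<in> {0..?D} \<Longrightarrow> t \<in> {0..?D} \<Longrightarrow> mdist T (\<gamma> s) (\<gamma> t) = \<bar>s - t\<bar>"
    "\<And>s. s \<in> {0..?D} \<Longrightarrow> \<gamma> s \<in> mspace T"
    using \<gamma> unfolding geodesic_from_def by blast+
  have inj: "s = t" if "s \<in> {0..?D}" "t \<in> {0..?D}" "\<gamma> s = \<gamma> t" for s t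
    using iso(1)[OF that(1,2)] iso(2)[OF that(1)] that(3) mdist_zero[of "\<gamma> t" T "\<gamma> t"] by auto
  have img: "(*) ?D ` {0..1} = {0..?D}"
    using D by (simp add: image_mult_atLeastAtMost)
  show "\<exists>A. arc_between (mtopology_of T) x y A \<and>
           isometric_spaces (submetric T A) (submetric euclidean_metric {0..?D})"
  proof (intro exI conjI)
    have "embedding_map (top_of_set {0..1}) (mtopology_of T) (\<lambda>t. \<gamma> (?D * t))"
    proof (rule injective_closed_imp_embedding_map)
      show cont: "continuous_map (top_of_set {0..1}) (mtopology_of T) (\<lambda>t. \<gamma> (?D * t))"
        using geodesic_from_pathin[OF \<gamma>] by (simp add: pathin_def)
      show "closed_map (top_of_set {0..1}) (mtopology_of T) (\<lambda>t. \<gamma> (?D * t))"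
        by (rule continuous_imp_closed_map[OF cont])
          (simp_all add: compact_space_subtopology Metric_space.Hausdorff_space_mtopology mtopology_of_def)
      show "inj_on (\<lambda>t. \<gamma> (?D * t)) (topspace (top_of_set {0..1}))"
      proof (rule inj_onI)
        fix s t assume st: "s \<in> topspace (top_of_set {0..1})" "t \<in> topspace (top_of_set {0..1})" "\<gamma> (?D * s) = \<gamma> (?D * t)"
        then have "?D * s \<in> (*) ?D ` {0..1}" "?D * t \<in> (*) ?D ` {0..1}" by auto
        then have "?D * s \<in> {0..?D}" "?D * t \<in> {0..?D}" unfolding img by blast+
        then show "s = t" using inj st(3) D by force
      qed
    qed
    moreover have "A = (\<lambda>t. \<gamma> (?D * t)) ` {0..1}"
      unfolding A_def img[symmetric] by (simp add: image_image)
    ultimately show "arc_between (mtopology_of T) x y A"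
      unfolding arc_between_def using \<gamma> by (auto simp: geodesic_from_def)
    have AT: "A \<subseteq> mspace T" using iso(2) unfolding A_def by blast
    have x\<gamma>: "mdist T x (\<gamma> t) = t" if "t \<in> {0..?D}" for t
      by (rule geodesic_from_dist(1)[OF \<gamma> that])
    show "isometric_spaces (submetric T A) (submetric euclidean_metric {0..?D})"
      unfolding isometric_spaces_def
    proof (intro exI[of _ "mdist T x"] conjI)
      show "mdist T x ` mspace (submetric T A) = mspace (submetric euclidean_metric {0..?D})"
        using AT x\<gamma> by (simp add: Int_absorb2 A_def image_image)
      show "\<forall>u\<in>mspace (submetric T A). \<forall>v\<in>mspace (submetric T A).
          mdist (submetric euclidean_metric {0..?D}) (mdist T x u) (mdist T x v) = mdist (submetric T A) u v"
        using iso(1) x\<gamma> by (auto simp: A_def dist_real_def)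
    qed
  qed
qed

text \<open>Every component contains a whole nonempty member of the cover, and different components contain
  different ones. In case of equality nothing is left over: each component is such a member.\<close>

lemma components_of_finite_connected_cover:
  assumes fin: "finite \<W>" and cover: "topspace X = \<Union>\<W>"
    and conn: "\<forall>W\<in>\<W>. connectedin X W"
  shows "finite (connected_components_of X)" (is "finite ?K") 
    and "card (connected_components_of X) \<le> card \<W>"
    and "card (connected_components_of X) = card \<W> \<Longrightarrow> \<W> \<subseteq> connected_components_of X"
proof -
  have "\<exists>W\<in>\<W>. W \<subseteq> C \<and> W \<noteq> {}" if C: "C \<in> ?K" for C
  proof -
    obtain x where x: "x \<in> C" using nonempty_connected_components_of[OF C] by blast
    then obtain W where W: "W \<in> \<W>" "x \<in> W"
      using connected_components_of_subset[OF C] cover by blast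
    have "W \<subseteq> C"
      using connected_components_of_maximal[OF C bspec[OF conn W(1)]] W(2) x by (auto simp: disjnt_def)
    then show ?thesis using W by blast
  qed
  then obtain f where f: "\<And>C. C \<in> ?K \<Longrightarrow> f C \<in> \<W>" "\<And>C. C \<in> ?K \<Longrightarrow> f C \<subseteq> C" "\<And>C. C \<in> ?K \<Longrightarrow> f C \<noteq> {}"
    by metis
  have overlap: "C = C'" if "C \<in> ?K" "C' \<in> ?K" "x \<in> C" "x \<in> C'" for C C' x
    using connected_components_of_overlap[OF that(1,2)] that(3,4) by blast
  have inj: "inj_on f ?K"
  proof (rule inj_onI)
    fix C C' assume *: "C \<in> ?K" "C' \<in> ?K" "f C = f C'"
    obtain x where "x \<in> f C" using f(3)[OF *(1)] by blast
    then show "C = C'" using overlap[OF *(1,2)] f(2)[OF *(1)] f(2)[OF *(2)] *(3) by blast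
  qed
  have sub: "f ` ?K \<subseteq> \<W>" using f(1) by blast
  show "finite ?K" using inj_on_finite[OF inj sub fin] .
  show "card ?K \<le> card \<W>" using card_inj_on_le[OF inj sub fin] .
  assume "card ?K = card \<W>"
  then have im: "f ` ?K = \<W>"
    using card_image[OF inj] card_subset_eq[OF fin sub] by simp
  show "\<W> \<subseteq> ?K"
  proof
    fix W assume "W \<in> \<W>"
    then obtain C where C: "C \<in> ?K" "W = f C" using im by blast
    have "C \<subseteq> W"
    proof
      fix x assume x: "x \<in> C"
      then obtain W' where "x \<in> W'" "W' \<in> \<W>" using connected_components_of_subset[OF C(1)] cover by blast
      then obtain C' where C': "C' \<in> ?K" "x \<in> f C'" using im by blast
      then have "C' = C" using overlap[OF C'(1) C(1), of x] f(2)[OF C'(1)] x by blast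
      then show "x \<in> W" using C' C by simp
    qed
    then show "W \<in> ?K" using f(2)[OF C(1)] C by (metis subset_antisym)
  qed
qed

text \<open>Two points of a circle are still connected when a third point is removed. Hence a space in which
  any two points can be separated by one further point, here the only point on some level of a
  continuous function, contains no circle.\<close>

lemma no_simple_closed_curve:
  assumes sep: "\<And>p q. p \<in> topspace X \<Longrightarrow> q \<in> topspace X \<Longrightarrow> p \<noteq> q \<Longrightarrow>
     \<exists>u z. continuous_map X euclideanreal u \<and> z \<noteq> p \<and> z \<noteq> q \<and> 
        (\<exists>m. (u p < m \<and> m < u q \<or> u q < m \<and> m < u p) \<and> (\<forall>w\<in>topspace X. u w = m \<longrightarrow> w = z))"
  shows "\<not> simple_closed_curve_in X S"
proof
  let ?C = "sphere (0::complex) 1"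
  assume S: "simple_closed_curve_in X S"
  then have SX: "S \<subseteq> topspace X" and "top_of_set ?C homeomorphic_space subtopology X S"
    unfolding simple_closed_curve_in_def using homeomorphic_space_sym by blast+
  then obtain f where f: "homeomorphic_map (top_of_set ?C) (subtopology X S) f"
    unfolding homeomorphic_space by blast
  have fS: "f ` ?C = S" and inj: "inj_on f ?C"
    using homeomorphic_imp_surjective_map[OF f] homeomorphic_imp_injective_map[OF f] SX by auto
  have cont: "continuous_map (top_of_set ?C) X f"
    using homeomorphic_imp_continuous_map[OF f] by (simp add: continuous_map_in_subtopology)
  have conn: "connectedin X (f ` K)" if "K \<subseteq> ?C" "connected K" for K
    using connectedin_continuous_map_image[OF cont] that by (simp add: connectedin_subtopology)
  have "1 \<in> ?C" "-1 \<in> ?C" by auto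
  define p q where "p = f 1" and "q = f (-1)"
  have "(1::complex) \<noteq> -1" by simp
  then have pq: "p \<in> S" "q \<in> S" "p \<noteq> q"
    using fS inj_onD[OF inj _ \<open>1 \<in> ?C\<close> \<open>-1 \<in> ?C\<close>] \<open>1 \<in> ?C\<close> \<open>-1 \<in> ?C\<close>
    unfolding p_def q_def by blast+
  obtain u z m where u: "continuous_map X euclideanreal u" "z \<noteq> p" "z \<noteq> q"
     and m: "u p < m \<and> m < u q \<or> u q < m \<and> m < u p" "\<And>w. w \<in> topspace X \<Longrightarrow> u w = m \<Longrightarrow> w = z"
    using sep[of p q] pq SX by blast
  have hit: "z \<in> A" if A: "connectedin X A" "p \<in> A" "q \<in> A" for A
  proof -
    have "connected (u ` A)"
      using connectedin_continuous_map_image[OF u(1) A(1)] by simp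
    then have "m \<in> u ` A"
      using m(1) A(2,3) by (meson connectedD_interval imageI less_imp_le)
    then show ?thesis using m(2) connectedin_subset_topspace[OF A(1)] by blast
  qed
  have "z \<in> f ` ?C"
    by (rule hit) (use conn[of ?C] pq fS in \<open>auto simp: connected_sphere\<close>)
  then obtain c where c: "c \<in> ?C" "z = f c" by blast
  have "connected (?C - {c})"
  proof -
    have "?C - {c} homeomorphic {x::complex. 1 \<bullet> x = 0}"
      using c(1) by (intro homeomorphic_punctured_sphere_hyperplane) auto
    moreover have "connected {x::complex. 1 \<bullet> x = 0}"
      by (intro convex_connected convex_hyperplane)
    ultimately show ?thesis using homeomorphic_connectedness by blast
  qed
  then have "z \<in> f ` (?C - {c})"
    by (intro hit conn) (use pq u(2,3) c \<open>1 \<in> ?C\<close> \<open>-1 \<in> ?C\<close> in \<open>auto simp: p_def q_def\<close>)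
  then show False using c inj by (auto simp: inj_on_def)
qed

section \<open>Combs\<close>

text \<open>The path metric on the segment \<open>[0,1] \<times> {0}\<close> with a vertical hair over every point: to pass from
  one hair to another one has to go down to the base.\<close>

definition comb_dist :: "real \<times> real \<Rightarrow> real \<times> real \<Rightarrow> real" where
  "comb_dist p q = (if fst p = fst q then \<bar>snd p - snd q\<bar> else \<bar>fst p - fst q\<bar> + \<bar>snd p\<bar> + \<bar>snd q\<bar>)"

definition comb_points :: "(real \<Rightarrow> real) \<Rightarrow> (real \<times> real) set" where
  "comb_points h = {(x, y). 0 \<le> x \<and> x \<le> 1 \<and> 0 \<le> y \<and> y \<le> h x}"

text \<open>The comb has to live on a set of reals, and \<open>plane_code\<close> names each of its points by a real number.\<close>

definition plane_code :: "real \<times> real \<Rightarrow> real" where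
  "plane_code = (SOME e. inj e)"

definition comb :: "(real \<Rightarrow> real) \<Rightarrow> real metric" where
  "comb h = metric (plane_code ` comb_points h, \<lambda>u v. comb_dist (inv plane_code u) (inv plane_code v))"

lemma inj_plane_code: "inj plane_code"
proof -
  have "\<exists>e. bij_betw e ((UNIV :: real set) \<times> (UNIV :: real set)) (UNIV :: real set)"
    unfolding card_of_ordIso by (intro card_of_Times_same_infinite infinite_UNIV_char_0)
  then have "\<exists>e :: real \<times> real \<Rightarrow> real. inj e"
    unfolding bij_betw_def by auto
  then show ?thesis unfolding plane_code_def by (rule someI_ex)
qed

lemma inv_plane_code [simp]: "inv plane_code (plane_code p) = p"
  by (simp add: inj_plane_code)

lemma comb_dist_le: "comb_dist p q \<le> \<bar>fst p - fst q\<bar> + \<bar>snd p\<bar> + \<bar>snd q\<bar>"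
  by (auto simp: comb_dist_def)

lemma comb_metric_space:
  "Metric_space (plane_code ` comb_points h) (\<lambda>u v. comb_dist (inv plane_code u) (inv plane_code v))"
proof
  fix u v w
  show "0 \<le> comb_dist (inv plane_code u) (inv plane_code v)" by (simp add: comb_dist_def)
  show "comb_dist (inv plane_code u) (inv plane_code v) = comb_dist (inv plane_code v) (inv plane_code u)"
    by (simp add: comb_dist_def abs_minus_commute)
  assume uv: "u \<in> plane_code ` comb_points h" "v \<in> plane_code ` comb_points h"
  show "(comb_dist (inv plane_code u) (inv plane_code v) = 0) = (u = v)"
    using uv by (auto simp: comb_dist_def comb_points_def prod_eq_iff)
  assume w: "w \<in> plane_code ` comb_points h"
  show "comb_dist (inv plane_code u) (inv plane_code w) \<le>
      comb_dist (inv plane_code u) (inv plane_code v) + comb_dist (inv plane_code v) (inv plane_code w)"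
    unfolding comb_dist_def by (smt (verit))
qed

lemma mspace_comb [simp]: "mspace (comb h) = plane_code ` comb_points h"
  and mdist_comb [simp]: "mdist (comb h) (plane_code p) (plane_code q) = comb_dist p q"
  using Metric_space.mspace_metric[OF comb_metric_space[of h]] Metric_space.mdist_metric[OF comb_metric_space[of h]]
  by (simp_all add: comb_def)

text \<open>Points with \<open>h x = 0\<close> carry no hair. The second condition leaves room on both sides of a foot
  for arms as long as the hair; the third is what \<^const>\<open>GT\<close> asks of branch points, with constant \<open>1\<close>.\<close>

locale comb_heights =
  fixes h :: "real \<Rightarrow> real"
  assumes h_nonneg: "0 \<le> h x"
    and h_le: "0 < h x \<Longrightarrow> h x \<le> x \<and> h x \<le> 1 - x"
    and h_sep: "x \<noteq> y \<Longrightarrow> min (h x) (h y) \<le> \<bar>x - y\<bar>"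
begin

abbreviation "S \<equiv> comb_points h"

lemma comb_pointsD: "p \<in> S \<Longrightarrow> 0 \<le> fst p \<and> fst p \<le> 1 \<and> 0 \<le> snd p \<and> snd p \<le> h (fst p)"
  by (auto simp: comb_points_def)

lemma h_le_1: "h x \<le> 1"
  using h_le[of x] h_nonneg[of x] by (cases "h x > 0") auto

text \<open>Hairs reaching the level \<open>r\<close> are at least \<open>r\<close> apart. For this reason the comb is closed in the
  plane, and the Euclidean topology agrees with the one of the path metric: a point close to the
  inside of a hair is on that hair.\<close>

lemma tall_points_isolated:
  assumes "p \<in> S" "q \<in> S" "fst p \<noteq> fst q" "r \<le> snd p" "r \<le> snd q"
  shows "r \<le> \<bar>fst p - fst q\<bar>"
  using h_sep[of "fst p" "fst q"] assms comb_pointsD[of p] comb_pointsD[of q] by auto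

lemma closed_comb_points: "closed S"
proof -
  have "l \<in> S" if x: "\<And>n. x n \<in> S" and lim: "x \<longlonglongrightarrow> l" for x l
  proof -
    have fx: "(\<lambda>n. fst (x n)) \<longlonglongrightarrow> fst l" and sx: "(\<lambda>n. snd (x n)) \<longlonglongrightarrow> snd l"
      using lim by (auto intro: tendsto_fst tendsto_snd)
    have "0 \<le> fst l" "fst l \<le> 1" "0 \<le> snd l"
      using LIMSEQ_le_const[OF fx, of 0] LIMSEQ_le_const2[OF fx, of 1] LIMSEQ_le_const[OF sx, of 0] comb_pointsD[OF x]
      by blast+
    moreover have "snd l \<le> h (fst l)"
    proof (cases "snd l > 0")
      case True
      let ?r = "snd l / 2"
      have "\<forall>\<^sub>F n in sequentially. ?r < snd (x n)" 
        using order_tendstoD(1)[OF sx, of ?r] True by auto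
      moreover have "\<forall>\<^sub>F n in sequentially. dist (fst (x n)) (fst l) < ?r / 2"
        using tendstoD[OF fx, of "?r / 2"] True by auto
      ultimately have "\<forall>\<^sub>F n in sequentially. ?r < snd (x n) \<and> dist (fst (x n)) (fst l) < ?r / 2"
        by eventually_elim auto
      then obtain N where N: "\<And>n. n \<ge> N \<Longrightarrow> ?r < snd (x n) \<and> dist (fst (x n)) (fst l) < ?r / 2"
        unfolding eventually_sequentially by blast
      have eq: "fst (x n) = fst (x N)" if "n \<ge> N" for n
      proof (rule ccontr)
        assume "fst (x n) \<noteq> fst (x N)"
        then have "?r \<le> \<bar>fst (x n) - fst (x N)\<bar>"
          using N[OF that] N[of N] x by (intro tall_points_isolated) auto
        then show False using N[OF that] N[of N] True unfolding dist_real_def by linarith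
      qed
      have "(\<lambda>n. fst (x n)) \<longlonglongrightarrow> fst (x N)"
        by (rule tendsto_eventually[OF eventually_sequentiallyI[of N]]) (rule eq)
      then have fl: "fst l = fst (x N)" using LIMSEQ_unique[OF fx] by blast
      have "\<forall>n\<ge>N. snd (x n) \<le> h (fst l)"
      proof (intro allI impI)
        fix n assume "n \<ge> N"
        then show "snd (x n) \<le> h (fst l)" using comb_pointsD[OF x, of n] eq[of n] fl by simp
      qed
      then show ?thesis using LIMSEQ_le_const2[OF sx] by blast
    qed (use h_nonneg[of "fst l"] in simp)
    ultimately show ?thesis by (auto simp: comb_points_def split_beta)
  qed
  then show ?thesis unfolding closed_sequential_limits by blast
qed

lemma compact_comb_points: "compact S"
proof -
  have "S \<subseteq> {0..1} \<times> {0..1}"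
    using h_le_1 by (force simp: comb_points_def intro: order_trans)
  then have "bounded S"
    by (rule bounded_subset[rotated]) (simp add: bounded_Times)
  then show ?thesis using closed_comb_points compact_eq_bounded_closed by blast
qed

lemma continuous_map_plane_code: "continuous_map (top_of_set S) (mtopology_of (comb h)) plane_code"
proof -
  have "\<exists>\<delta>>0. \<forall>q\<in>S. dist p q < \<delta> \<longrightarrow> comb_dist p q < \<epsilon>" if p: "p \<in> S" and "\<epsilon> > 0" for p \<epsilon>
  proof -
    have fs: "\<bar>fst p - fst q\<bar> \<le> dist p q" "\<bar>snd p - snd q\<bar> \<le> dist p q" for q
      using dist_fst_le[of p q] dist_snd_le[of p q] unfolding dist_real_def by blast+
    show ?thesis
    proof (cases "snd p = 0")
      case True
      have "comb_dist p q < \<epsilon>" if "dist p q < \<epsilon> / 2" for q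
        using that fs[of q] comb_dist_le[of p q] True by auto
      then show ?thesis using \<open>\<epsilon> > 0\<close> by (intro exI[of _ "\<epsilon> / 2"]) auto
    next
      case False
      then have pos: "snd p > 0" using comb_pointsD[OF p] by auto
      have "comb_dist p q < \<epsilon>" if q: "q \<in> S" "dist p q < min \<epsilon> (snd p / 2)" for q
      proof -
        have "snd p / 2 \<le> snd q" using fs(2)[of q] q(2) by auto
        then have "fst p = fst q"
          using tall_points_isolated[OF p q(1), of "snd p / 2"] fs(1)[of q] q(2) pos by force
        then show ?thesis using fs(2)[of q] q(2) by (simp add: comb_dist_def)
      qed
      then show ?thesis using \<open>\<epsilon> > 0\<close> pos by (intro exI[of _ "min \<epsilon> (snd p / 2)"]) auto
    qed
  qed
  then have "\<forall>p\<in>S. \<forall>\<epsilon>>0. \<exists>\<delta>>0. \<forall>q. q \<in> S \<and> dist p q < \<delta> \<longrightarrow> comb_dist p q < \<epsilon>" by meson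
  then have "continuous_map (mtopology_of (submetric euclidean_metric S)) (mtopology_of (comb h)) plane_code"
    unfolding mtopology_of_def Metric_space.metric_continuous_map[OF Metric_space_mspace_mdist Metric_space_mspace_mdist]
    by simp
  then show ?thesis by (simp add: mtopology_of_submetric)
qed

lemma compact_comb: "compact_space (mtopology_of (comb h))"
proof -
  have "compactin (top_of_set S) S" using compact_comb_points by (simp add: compactin_subtopology)
  from image_compactin[OF this continuous_map_plane_code]
  show ?thesis by (simp add: compact_space_def)
qed

lemma connectedin_comb:
  assumes "connected W" "W \<subseteq> S"
  shows "connectedin (mtopology_of (comb h)) (plane_code ` W)"
  using connectedin_continuous_map_image[OF continuous_map_plane_code] assms by (simp add: connectedin_subtopology)

lemma geodesic_vertical:
  assumes "(x, y) \<in> S" "(x, y') \<in> S" "y \<le> y'"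
  shows "geodesic_from (comb h) (\<lambda>t. plane_code (x, y + t)) (plane_code (x, y)) (plane_code (x, y'))"
  using assms unfolding geodesic_from_def by (auto simp: comb_dist_def comb_points_def)

lemma geodesic_horizontal:
  assumes "0 \<le> x" "x \<le> x'" "x' \<le> 1"
  shows "geodesic_from (comb h) (\<lambda>t. plane_code (x + t, 0)) (plane_code (x, 0)) (plane_code (x', 0))"
  using assms h_nonneg unfolding geodesic_from_def by (auto simp: comb_dist_def comb_points_def)

lemma geodesic_comb: "geodesic_space (comb h)"
proof -
  have rev: "\<exists>\<gamma>. geodesic_from (comb h) \<gamma> q p" if "\<exists>\<gamma>. geodesic_from (comb h) \<gamma> p q" for p q
    using that geodesic_from_reverse[of "comb h" _ p q] by blast
  have vertical: "\<exists>\<gamma>. geodesic_from (comb h) \<gamma> (plane_code (x, y)) (plane_code (x, y'))"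
    if "(x, y) \<in> S" "(x, y') \<in> S" for x y y'
    using geodesic_vertical[OF that] geodesic_vertical[OF that(2,1)] rev by (cases "y \<le> y'") (blast, fastforce)
  have horizontal: "\<exists>\<gamma>. geodesic_from (comb h) \<gamma> (plane_code (x, 0)) (plane_code (x', 0))"
    if "x \<in> {0..1}" "x' \<in> {0..1}" for x x'
    using geodesic_horizontal[of x x'] geodesic_horizontal[of x' x] that rev
    by (cases "x \<le> x'") (force, fastforce)
  have join: "\<exists>\<gamma>. geodesic_from (comb h) \<gamma> p q"
    if "\<exists>\<gamma>. geodesic_from (comb h) \<gamma> p z" "\<exists>\<gamma>. geodesic_from (comb h) \<gamma> z q" 
      "mdist (comb h) p z + mdist (comb h) z q = mdist (comb h) p q" for p q z
    using that(1,2) geodesic_join[OF _ _ that(3)] by metis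
  show ?thesis
    unfolding geodesic_space_def mspace_comb
  proof (clarsimp simp del: mdist_comb)
    fix x y x' y' assume S: "(x, y) \<in> S" "(x', y') \<in> S"
    then have S0: "(x, 0) \<in> S" "(x', 0) \<in> S" and r: "x \<in> {0..1}" "x' \<in> {0..1}" "0 \<le> y" "0 \<le> y'"
      by (auto simp: comb_points_def h_nonneg)
    show "\<exists>\<gamma>. geodesic_from (comb h) \<gamma> (plane_code (x, y)) (plane_code (x', y'))"
    proof (cases "x = x'")
      case True
      then show ?thesis using vertical S by blast
    next
      case False
      have "\<exists>\<gamma>. geodesic_from (comb h) \<gamma> (plane_code (x, y)) (plane_code (x', 0))"
        by (rule join[OF vertical[OF S(1) S0(1)] horizontal[OF r(1,2)]]) (use False r in \<open>auto simp: comb_dist_def\<close>)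
      then show ?thesis
        by (rule join[OF _ vertical[OF S0(2) S(2)]]) (use False r in \<open>auto simp: comb_dist_def\<close>)
    qed
  qed
qed

lemma comb_continuous_function:
  assumes "\<And>p q. p \<in> S \<Longrightarrow> q \<in> S \<Longrightarrow> \<bar>u p - u q\<bar> \<le> comb_dist p q"
  shows "continuous_map (mtopology_of (comb h)) euclideanreal (u \<circ> inv plane_code)"
proof -
  have "Lipschitz_continuous_map (comb h) euclidean_metric (u \<circ> inv plane_code)"
    unfolding Lipschitz_continuous_map_def using assms
    by (auto simp: dist_real_def intro!: exI[of _ 1])
  then show ?thesis using Lipschitz_continuous_imp_continuous_map[of "comb h" euclidean_metric] by simp
qed

text \<open>Two points of one hair are separated by the height along that hair. Two points over
  different feet are separated by the first coordinate; the midpoint \<open>m\<close> between the feet may carry a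
  hair itself, which is pushed to the left of \<open>m\<close> by subtracting the height along it.\<close>

lemma no_simple_closed_curve_comb: "\<not> simple_closed_curve_in (mtopology_of (comb h)) C"
proof (rule no_simple_closed_curve)
  fix u v assume "u \<in> topspace (mtopology_of (comb h))" "v \<in> topspace (mtopology_of (comb h))" "u \<noteq> v"
  then obtain p q where pq: "p \<in> S" "q \<in> S" "p \<noteq> q" "u = plane_code p" "v = plane_code q" by auto
  have "\<exists>f z m. (\<forall>p\<in>S. \<forall>q\<in>S. \<bar>f p - f q\<bar> \<le> comb_dist p q) \<and> z \<noteq> p \<and> z \<noteq> q \<and>
      (f p < m \<and> m < f q \<or> f q < m \<and> m < f p) \<and> (\<forall>w\<in>S. f w = m \<longrightarrow> w = z)"
  proof (cases "fst p = fst q")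
    case True
    define m where "m = (snd p + snd q) / 2"
    have neq: "snd p \<noteq> snd q" using pq(3) True by (auto simp: prod_eq_iff)
    have "m > 0" using neq comb_pointsD[OF pq(1)] comb_pointsD[OF pq(2)] by (auto simp: m_def)
    show ?thesis
      by (intro exI[of _ "\<lambda>w. if fst w = fst p then snd w else 0"] exI[of _ "(fst p, m)"] exI[of _ m])
        (use \<open>m > 0\<close> neq True in \<open>auto simp: m_def comb_dist_def prod_eq_iff field_simps\<close>)
  next
    case False
    define m where "m = (fst p + fst q) / 2"
    show ?thesis
      by (intro exI[of _ "\<lambda>w. fst w - (if fst w = m then snd w else 0)"] exI[of _ "(m, 0)"] exI[of _ m])
        (use False in \<open>auto simp: m_def comb_dist_def prod_eq_iff field_simps\<close>)
  qed
  then obtain f z m where f: "\<And>p q. p \<in> S \<Longrightarrow> q \<in> S \<Longrightarrow> \<bar>f p - f q\<bar> \<le> comb_dist p q" "z \<noteq> p" "z \<noteq> q" 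
      "f p < m \<and> m < f q \<or> f q < m \<and> m < f p" "\<And>w. w \<in> S \<Longrightarrow> f w = m \<Longrightarrow> w = z"
    by metis
  have "continuous_map (mtopology_of (comb h)) euclideanreal (f \<circ> inv plane_code)"
    by (rule comb_continuous_function) (rule f(1))
  moreover have "plane_code z \<noteq> u" "plane_code z \<noteq> v"
    using f(2,3) pq by (simp_all add: inj_eq[OF inj_plane_code])
  ultimately show "\<exists>g z. continuous_map (mtopology_of (comb h)) euclideanreal g \<and> z \<noteq> u \<and> z \<noteq> v \<and> 
        (\<exists>m. (g u < m \<and> m < g v \<or> g v < m \<and> m < g u) \<and> (\<forall>w\<in>topspace (mtopology_of (comb h)). g w = m \<longrightarrow> w = z))"
    by (intro exI[of _ "f \<circ> inv plane_code"] exI[of _ "plane_code z"] conjI exI[of _ m])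
      (use f(4,5) pq in auto)
qed

lemma geodesic_tree_comb: "geodesic_tree (comb h)"
proof (rule geodesic_treeI[OF _ compact_comb geodesic_comb no_simple_closed_curve_comb])
  have "(0, 0) \<in> S" by (simp add: comb_points_def h_nonneg)
  then show "mspace (comb h) \<noteq> {}" by auto
qed

text \<open>Such a set is the union of an interval on the base with vertical segments that meet it.\<close>

lemma connected_downward_closed:
  assumes "W \<subseteq> S" and down: "\<And>x y y'. (x, y) \<in> W \<Longrightarrow> 0 \<le> y' \<Longrightarrow> y' \<le> y \<Longrightarrow> (x, y') \<in> W"
    and conv: "convex {x. (x, 0) \<in> W}"
  shows "connected W"
proof (cases "W = {}")
  case False
  define B where "B = {x. (x, 0) \<in> W} \<times> {0::real}"
  have "W = (\<Union>w\<in>W. B \<union> {fst w} \<times> {0..snd w})"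
  proof (intro equalityI subsetI)
    fix v assume "v \<in> W"
    then show "v \<in> (\<Union>w\<in>W. B \<union> {fst w} \<times> {0..snd w})"
      using assms(1) comb_pointsD[of v] by (intro UN_I[of v] UnI2) (auto simp: mem_Times_iff)
  next
    fix v assume "v \<in> (\<Union>w\<in>W. B \<union> {fst w} \<times> {0..snd w})"
    then consider "v \<in> B" | w where "w \<in> W" "v \<in> {fst w} \<times> {0..snd w}"
      unfolding UN_iff Un_iff by metis
    then show "v \<in> W"
    proof cases
      case 2
      then show ?thesis using down[of "fst w" "snd w" "snd v"] by (cases w, cases v) auto
    qed (auto simp: B_def)
  qed
  moreover have "connected (\<Union>w\<in>W. B \<union> {fst w} \<times> {0..snd w})"
  proof (rule connected_Union)
    fix V assume "V \<in> (\<lambda>w. B \<union> {fst w} \<times> {0..snd w}) ` W"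
    then obtain x y where V: "V = B \<union> {x} \<times> {0..y}" "(x, y) \<in> W" by auto
    have "0 \<le> y" using assms(1) V(2) comb_pointsD[of "(x, y)"] by auto
    then have "(x, 0) \<in> B \<inter> {x} \<times> {0..y}"
      using V(2) down[OF V(2), of 0] by (simp add: B_def)
    moreover have "convex B" "convex ({x} \<times> {0..y})"
      unfolding B_def using conv by (auto intro: convex_Times)
    ultimately show "connected V"
      unfolding V(1) by (intro connected_Un convex_connected) auto
  next
    obtain x y where "(x, y) \<in> W" using False by auto
    then have "(x, 0) \<in> B" using down[of x y 0] assms(1) comb_pointsD[of "(x, y)"] by (auto simp: B_def)
    then show "\<Inter> ((\<lambda>w. B \<union> {fst w} \<times> {0..snd w}) ` W) \<noteq> {}" by blast
  qed
  ultimately show ?thesis by simp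
qed auto

lemma branches_comb_cover:
  assumes z: "z \<in> S" and fin: "finite \<V>" and cover: "\<Union>\<V> = S - {z}" and conn: "\<forall>V\<in>\<V>. connected V"
  shows "finite (branches (comb h) (plane_code z))"
    and "card (branches (comb h) (plane_code z)) \<le> card \<V>"
    and "card (branches (comb h) (plane_code z)) = card \<V> \<Longrightarrow> V \<in> \<V> \<Longrightarrow> plane_code ` V \<in> branches (comb h) (plane_code z)"
proof -
  let ?X = "subtopology (mtopology_of (comb h)) (mspace (comb h) - {plane_code z})"
  let ?W = "(`) plane_code ` \<V>"
  have "topspace ?X = plane_code ` S - {plane_code z}" by auto
  also have "\<dots> = plane_code ` (S - {z})"
    by (simp add: image_set_diff[OF inj_plane_code])
  also have "\<dots> = \<Union>?W" unfolding cover[symmetric] by blast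
  finally have top: "topspace ?X = \<Union>?W" .
  have "\<forall>W\<in>?W. connectedin ?X W"
  proof
    fix W assume W: "W \<in> ?W"
    obtain V where V: "V \<in> \<V>" "W = plane_code ` V" using W by blast
    then have "V \<subseteq> S" using cover by blast
    then have "connectedin (mtopology_of (comb h)) W"
      unfolding V(2) by (rule connectedin_comb[OF bspec[OF conn V(1)]])
    moreover have "W \<subseteq> topspace ?X" unfolding top using W by blast
    ultimately show "connectedin ?X W" by (auto simp: connectedin_subtopology)
  qed
  note * = components_of_finite_connected_cover[OF finite_imageI[OF fin] top this]
  have le: "card ?W \<le> card \<V>" by (rule card_image_le[OF fin])
  show "finite (branches (comb h) (plane_code z))"
    unfolding branches_def by (rule *(1))
  show "card (branches (comb h) (plane_code z)) \<le> card \<V>"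
    unfolding branches_def using *(2) le by linarith
  assume "card (branches (comb h) (plane_code z)) = card \<V>" "V \<in> \<V>"
  then have "card (connected_components_of ?X) = card ?W"
    unfolding branches_def using *(2) le by linarith
  from *(3)[OF this] show "plane_code ` V \<in> branches (comb h) (plane_code z)"
    unfolding branches_def using \<open>V \<in> \<V>\<close> by blast
qed

lemma branches_on_hair:
  assumes z: "(a, b) \<in> S" "0 < b"
  shows "finite (branches (comb h) (plane_code (a, b)))" "card (branches (comb h) (plane_code (a, b))) \<le> 2"
proof -
  define V where "V = {w \<in> S. \<not> (fst w = a \<and> snd w \<ge> b)}"
  define W where "W = {a} \<times> {b<..h a}"
  have a: "0 \<le> a" "a \<le> 1" using z by (auto simp: comb_points_def)
  have "connected V"
  proof (rule connected_downward_closed)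
    have "{x. (x, 0) \<in> V} = {0..1}" using \<open>0 < b\<close> h_nonneg by (auto simp: V_def comb_points_def)
    then show "convex {x. (x, 0) \<in> V}" by simp
  qed (auto simp: V_def comb_points_def)
  moreover have "connected W"
    unfolding W_def by (intro convex_connected convex_Times) auto
  moreover have cover: "\<Union>{V, W} = S - {(a, b)}"
    using z a by (auto simp: V_def W_def comb_points_def)
  ultimately have conn: "\<forall>X\<in>{V, W}. connected X" and cover: "\<Union>{V, W} = S - {(a, b)}" by blast+
  note * = branches_comb_cover[OF z(1) _ cover conn]
  show "finite (branches (comb h) (plane_code (a, b)))" using *(1) by blast
  have "card {V, W} \<le> 2" by (simp add: card_insert_if)
  then show "card (branches (comb h) (plane_code (a, b))) \<le> 2" using *(2) by fastforce
qed

text \<open>The candidates are the parts to the left and to the right of \<open>a\<close> and the hair. If there are three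
  branches, then the hair is one of them and bounds the height.\<close>

lemma branches_on_base:
  assumes z: "(a, 0) \<in> S"
  shows "finite (branches (comb h) (plane_code (a, 0)))" "card (branches (comb h) (plane_code (a, 0))) \<le> 3"
    and "card (branches (comb h) (plane_code (a, 0))) = 3 \<Longrightarrow> height (comb h) (plane_code (a, 0)) \<le> h a"
proof -
  let ?K = "branches (comb h) (plane_code (a, 0))"
  define L where "L = {w \<in> S. fst w < a}"
  define R where "R = {w \<in> S. a < fst w}"
  define W where "W = {a} \<times> {0<..h a}"
  have a: "0 \<le> a" "a \<le> 1" using z by (auto simp: comb_points_def)
  have "connected L"
  proof (rule connected_downward_closed)
    have "{x. (x, 0) \<in> L} = {0..<a}" using a h_nonneg by (auto simp: L_def comb_points_def)
    then show "convex {x. (x, 0) \<in> L}" by simp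
  qed (auto simp: L_def comb_points_def)
  moreover have "connected R"
  proof (rule connected_downward_closed)
    have "{x. (x, 0) \<in> R} = {a<..1}" using a h_nonneg by (auto simp: R_def comb_points_def)
    then show "convex {x. (x, 0) \<in> R}" by simp
  qed (auto simp: R_def comb_points_def)
  moreover have "connected W"
    unfolding W_def by (intro convex_connected convex_Times) auto
  moreover have "\<Union>{L, R, W} = S - {(a, 0)}"
  proof (intro equalityI subsetI)
    fix w assume w: "w \<in> S - {(a, 0)}"
    consider "fst w < a" | "a < fst w" | "fst w = a" by linarith
    then show "w \<in> \<Union>{L, R, W}"
      using w by cases (auto simp: L_def R_def W_def comb_points_def)
  qed (use a in \<open>auto simp: L_def R_def W_def comb_points_def\<close>)
  ultimately have conn: "\<forall>X\<in>{L, R, W}. connected X" and cover: "\<Union>{L, R, W} = S - {(a, 0)}" by blast+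
  note * = branches_comb_cover[OF z _ cover conn]
  show fin: "finite ?K" using *(1) by blast
  have le: "card {L, R, W} \<le> 3" by (simp add: card_insert_if)
  have le': "card ?K \<le> card {L, R, W}" using *(2) by blast
  show "card ?K \<le> 3" using le le' by linarith
  assume 3: "card ?K = 3"
  then have "card ?K = card {L, R, W}" using le le' by linarith
  then have W: "plane_code ` W \<in> ?K" using *(3)[of W] by blast
  then have "W \<noteq> {}" using nonempty_connected_components_of unfolding branches_def by blast
  have "height (comb h) (plane_code (a, 0)) \<le> mdiam (comb h) (plane_code ` W)"
    by (rule height_le[OF fin 3 W])
  also have "\<dots> \<le> h a"
    unfolding mdiam_def
  proof (rule cSUP_least)
    show "plane_code ` W \<times> plane_code ` W \<noteq> {}" using \<open>W \<noteq> {}\<close> by simp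
    fix uv assume "uv \<in> plane_code ` W \<times> plane_code ` W"
    then show "(case uv of (u, v) \<Rightarrow> mdist (comb h) u v) \<le> h a"
      by (auto simp: W_def comb_dist_def)
  qed
  finally show "height (comb h) (plane_code (a, 0)) \<le> h a" .
qed

text \<open>All branch points are feet, and the height of a foot \<open>a\<close> is at most \<open>h a\<close>.\<close>

lemma comb_in_GT:
  assumes "n \<ge> 3" "0 < c" "c \<le> 1"
  shows "comb h \<in> GT n c"
proof -
  have val: "valence (comb h) p \<le> 3 \<and> (valence (comb h) p = 3 \<longrightarrow> (\<exists>a. (a, 0) \<in> S \<and> p = plane_code (a, 0) \<and> height (comb h) p \<le> h a))"
    if pT: "p \<in> mspace (comb h)" for p
  proof -
    obtain w where w: "p = plane_code w" "w \<in> S" using pT unfolding mspace_comb by blast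
    obtain a b where "w = (a, b)" by (cases w)
    then have p: "p = plane_code (a, b)" "(a, b) \<in> S" using w by auto
    show ?thesis
    proof (cases "b = 0")
      case True
      then show ?thesis
        using branches_on_base[of a] p by (auto simp: valence_def numeral_eq_enat)
    next
      case False
      then have "0 < b" using p by (auto simp: comb_points_def)
      then show ?thesis
        using branches_on_hair[OF p(2)] p by (auto simp: valence_def numeral_eq_enat)
    qed
  qed
  have "Val (comb h) \<le> 3"
    unfolding Val_def by (rule SUP_least) (use val in blast)
  also have "(3::enat) \<le> enat n" using assms(1) by (simp add: numeral_eq_enat)
  finally have "Val (comb h) \<le> enat n" .
  moreover have "c * min (height (comb h) p) (height (comb h) q) \<le> mdist (comb h) p q"
    if pq: "p \<in> branch_points (comb h)" "q \<in> branch_points (comb h)" "p \<noteq> q" for p q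
  proof -
    have "\<exists>a. (a, 0) \<in> S \<and> r = plane_code (a, 0) \<and> height (comb h) r \<le> h a" if "r \<in> branch_points (comb h)" for r
      using that val[of r] unfolding branch_points_def by (auto intro: antisym)
    then obtain a b where ab: "p = plane_code (a, 0)" "height (comb h) p \<le> h a" "q = plane_code (b, 0)" "height (comb h) q \<le> h b"
      using pq by meson
    then have "a \<noteq> b" using pq(3) by auto
    have "c * min (height (comb h) p) (height (comb h) q) \<le> c * min (h a) (h b)"
      using ab assms(2) by (intro mult_left_mono) auto
    also have "\<dots> \<le> 1 * min (h a) (h b)"
      using assms h_nonneg by (intro mult_right_mono) auto
    also have "\<dots> \<le> \<bar>a - b\<bar>" using h_sep[OF \<open>a \<noteq> b\<close>] by simp
    also have "\<dots> = mdist (comb h) p q" unfolding ab using \<open>a \<noteq> b\<close> by (simp add: comb_dist_def)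
    finally show ?thesis .
  qed
  ultimately show ?thesis
    unfolding GT_def using geodesic_tree_comb by auto
qed

end

section \<open>Choosing marks against finitely many opponents\<close>

lemma card_separated_le:
  fixes A :: "real set"
  assumes sep: "\<And>x y. x \<in> A \<Longrightarrow> y \<in> A \<Longrightarrow> x \<noteq> y \<Longrightarrow> \<sigma> \<le> \<bar>x - y\<bar>" and "\<sigma> > 0"
    and A: "A \<subseteq> {a..a + L}"
  shows "finite A" "card A \<le> nat \<lfloor>L / \<sigma>\<rfloor> + 1"
proof -
  define f where "f x = \<lfloor>(x - a) / \<sigma>\<rfloor>" for x
  have inj: "inj_on f A"
  proof (rule inj_onI, rule ccontr)
    fix x y assume xy: "x \<in> A" "y \<in> A" "f x = f y" "x \<noteq> y"
    have "\<bar>(x - a) / \<sigma> - (y - a) / \<sigma>\<bar> < 1"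
      using xy(3) unfolding f_def by linarith
    moreover have "(x - a) / \<sigma> - (y - a) / \<sigma> = (x - y) / \<sigma>" by (simp add: diff_divide_distrib)
    ultimately have "\<bar>x - y\<bar> < \<sigma>" using \<open>\<sigma> > 0\<close> by (simp add: abs_divide)
    then show False using sep[OF xy(1,2,4)] by simp
  qed
  have sub: "f ` A \<subseteq> {0..\<lfloor>L / \<sigma>\<rfloor>}"
  proof
    fix n assume "n \<in> f ` A"
    then obtain x where x: "x \<in> A" "n = f x" by blast
    then have "0 \<le> (x - a) / \<sigma>" "(x - a) / \<sigma> \<le> L / \<sigma>"
      using A \<open>\<sigma> > 0\<close> by (auto intro!: divide_right_mono)
    then show "n \<in> {0..\<lfloor>L / \<sigma>\<rfloor>}" unfolding x f_def by (auto intro: floor_mono)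
  qed
  show "finite A" using inj_on_finite[OF inj sub] by simp
  have "card A \<le> card {0..\<lfloor>L / \<sigma>\<rfloor>}" using card_inj_on_le[OF inj sub] by simp
  then show "card A \<le> nat \<lfloor>L / \<sigma>\<rfloor> + 1"
    by (cases "\<lfloor>L / \<sigma>\<rfloor> \<ge> 0") (auto simp: nat_add_distrib)
qed

text \<open>The opponent \<open>w\<close> scores in round \<open>i\<close> if \<open>s i\<close> hits its set \<open>G i w\<close>, and each score multiplies
  its weight by \<open>Z\<close>. For a uniformly random element of \<open>\<Sigma>\<close> the expected factor is at most \<open>2\<close>, so some
  element at most doubles the total weight.\<close>

lemma weighted_choice:
  fixes Z :: real
  assumes W: "finite W" and \<Sigma>: "finite \<Sigma>" "\<Sigma> \<noteq> {}" and Z: "1 \<le> Z"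
    and G: "\<And>i w. i < N \<Longrightarrow> w \<in> W \<Longrightarrow> G i w \<subseteq> \<Sigma> \<and> card (G i w) * Z \<le> card \<Sigma>"
  shows "\<exists>s. (\<forall>i<N. s i \<in> \<Sigma>) \<and> (\<Sum>w\<in>W. Z ^ card {i. i < N \<and> s i \<in> G i w}) \<le> card W * 2 ^ N"
  using G
proof (induction N)
  case 0
  then show ?case by auto
next
  case (Suc N)
  have "\<exists>s. (\<forall>i<N. s i \<in> \<Sigma>) \<and> (\<Sum>w\<in>W. Z ^ card {i. i < N \<and> s i \<in> G i w}) \<le> card W * 2 ^ N"
    by (rule Suc.IH) (simp add: Suc.prems)
  then obtain s where s: "\<forall>i<N. s i \<in> \<Sigma>"
      "(\<Sum>w\<in>W. Z ^ card {i. i < N \<and> s i \<in> G i w}) \<le> card W * 2 ^ N" by blast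
  define a where "a w = Z ^ card {i. i < N \<and> s i \<in> G i w}" for w
  have a: "0 \<le> a w" for w using Z by (simp add: a_def)
  define b where "b x w = (if x \<in> G N w then Z else 1)" for x w
  have "\<exists>x\<in>\<Sigma>. (\<Sum>w\<in>W. a w * b x w) \<le> 2 * (\<Sum>w\<in>W. a w)"
  proof (rule ccontr)
    assume "\<not> ?thesis"
    then have "(\<Sum>x\<in>\<Sigma>. 2 * (\<Sum>w\<in>W. a w)) < (\<Sum>x\<in>\<Sigma>. \<Sum>w\<in>W. a w * b x w)"
      by (intro sum_strict_mono \<Sigma>) auto
    also have "\<dots> = (\<Sum>w\<in>W. a w * (\<Sum>x\<in>\<Sigma>. b x w))"
      by (subst sum.swap) (simp add: sum_distrib_left)
    also have "\<dots> \<le> (\<Sum>w\<in>W. a w * (2 * card \<Sigma>))"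
    proof (intro sum_mono mult_left_mono a)
      fix w assume "w \<in> W"
      then have G: "G N w \<subseteq> \<Sigma>" "card (G N w) * Z \<le> card \<Sigma>" using Suc.prems[of N w] by auto
      have "(\<Sum>x\<in>\<Sigma>. b x w) = (\<Sum>x\<in>G N w. Z) + (\<Sum>x\<in>\<Sigma> - G N w. 1)"
        unfolding b_def using G(1) \<Sigma>(1) by (subst sum.If_cases) (auto simp: Int_absorb1 Diff_eq)
      also have "\<dots> \<le> card \<Sigma> + card \<Sigma>"
        using G(2) card_mono[OF \<Sigma>(1), of "\<Sigma> - G N w"] by simp
      finally show "(\<Sum>x\<in>\<Sigma>. b x w) \<le> 2 * card \<Sigma>" by simp
    qed
    also have "\<dots> = (\<Sum>x\<in>\<Sigma>. 2 * (\<Sum>w\<in>W. a w))"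
      by (simp add: sum_distrib_left sum_distrib_right mult_ac)
    finally show False by simp
  qed
  then obtain x where x: "x \<in> \<Sigma>" "(\<Sum>w\<in>W. a w * b x w) \<le> 2 * (\<Sum>w\<in>W. a w)" by blast
  define s' where "s' = s(N := x)"
  have "Z ^ card {i. i < Suc N \<and> s' i \<in> G i w} = a w * b x w" for w
  proof -
    have "{i. i < Suc N \<and> s' i \<in> G i w} = {i. i < N \<and> s i \<in> G i w} \<union> (if x \<in> G N w then {N} else {})"
      by (auto simp: s'_def less_Suc_eq)
    then show ?thesis by (auto simp: a_def b_def)
  qed
  then have "(\<Sum>w\<in>W. Z ^ card {i. i < Suc N \<and> s' i \<in> G i w}) \<le> 2 * (\<Sum>w\<in>W. a w)"
    using x by simp
  also have "\<dots> \<le> card W * 2 ^ Suc N" using s(2) unfolding a_def by simp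
  finally show ?case using s(1) x(1) by (intro exI[of _ s']) (auto simp: s'_def less_Suc_eq)
qed

text \<open>An opponent that scores in more than half of the rounds would have weight \<open>z\<^sup>2 ^ card \<dots> \<ge> z ^ (N + 1)\<close>, more
  than the total weight \<open>M * B ^ N * 2 ^ N\<close>.\<close>

lemma choice_hitting_at_most_half:
  fixes z :: real
  assumes W: "finite W" "card W \<le> M * B ^ N" and \<Sigma>: "finite \<Sigma>" "\<Sigma> \<noteq> {}" 
    and z: "2 * B \<le> z" "M < z" "1 \<le> z"
    and G: "\<And>i w. i < N \<Longrightarrow> w \<in> W \<Longrightarrow> G i w \<subseteq> \<Sigma> \<and> card (G i w) * z\<^sup>2 \<le> card \<Sigma>"
  shows "\<exists>s. (\<forall>i<N. s i \<in> \<Sigma>) \<and> (\<forall>w\<in>W. 2 * card {i. i < N \<and> s i \<in> G i w} \<le> N)"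
proof -
  have "1 \<le> z\<^sup>2" using z(3) by simp
  have "\<exists>s. (\<forall>i<N. s i \<in> \<Sigma>) \<and> (\<Sum>w\<in>W. z\<^sup>2 ^ card {i. i < N \<and> s i \<in> G i w}) \<le> card W * 2 ^ N"
    by (rule weighted_choice[OF W(1) \<Sigma> \<open>1 \<le> z\<^sup>2\<close>]) (rule G)
  then obtain s where 
    s: "\<forall>i<N. s i \<in> \<Sigma>" "(\<Sum>w\<in>W. z\<^sup>2 ^ card {i. i < N \<and> s i \<in> G i w}) \<le> card W * 2 ^ N" by blast
  have "2 * card {i. i < N \<and> s i \<in> G i w} \<le> N" if w: "w \<in> W" for w
  proof (rule ccontr)
    let ?c = "card {i. i < N \<and> s i \<in> G i w}"
    assume "\<not> 2 * ?c \<le> N"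
    then have "z ^ Suc N \<le> z ^ (2 * ?c)" using z(3) by (intro power_increasing) auto
    also have "\<dots> = z\<^sup>2 ^ ?c" by (simp add: power_mult)
    also have "\<dots> \<le> (\<Sum>w\<in>W. z\<^sup>2 ^ card {i. i < N \<and> s i \<in> G i w})"
      using w W(1) by (intro member_le_sum) auto
    also have "\<dots> \<le> card W * 2 ^ N" by (rule s)
    also have "\<dots> \<le> (M * B ^ N) * 2 ^ N"
      using W(2) by (intro of_nat_mono mult_right_mono) auto
    also have "\<dots> = M * (2 * real B) ^ N" by (simp add: power_mult_distrib)
    also have "\<dots> \<le> M * z ^ N" using z(1) by (intro mult_left_mono power_mono) auto
    also have "\<dots> < z * z ^ N" using z by (intro mult_strict_right_mono) auto
    finally show False by simp
  qed
  then show ?thesis using s(1) by blast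
qed

text \<open>The value \<open>0\<close> beyond \<open>N\<close> makes a path determined by its first \<open>N\<close> steps, so that paths can be
  counted.\<close>

definition step_paths :: "(real \<Rightarrow> real set) \<Rightarrow> nat \<Rightarrow> (nat \<Rightarrow> real) set" where
  "step_paths step N = {t. t 0 = 0 \<and> (\<forall>i<N. t (Suc i) \<in> step (t i)) \<and> (\<forall>i>N. t i = 0)}"

lemma card_step_paths:
  assumes "\<And>v. finite (step v) \<and> card (step v) \<le> B"
  shows "finite (step_paths step N)" "card (step_paths step N) \<le> B ^ N"
proof -
  have "finite (step_paths step N) \<and> card (step_paths step N) \<le> B ^ N"
  proof (induction N)
    case 0
    have "step_paths step 0 \<subseteq> {\<lambda>_. 0}"
    proof
      fix t assume "t \<in> step_paths step 0"
      then have "t i = 0" for i by (cases i) (auto simp: step_paths_def)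
      then show "t \<in> {\<lambda>_. 0}" by auto
    qed
    then show ?case using finite_subset card_mono[of "{\<lambda>_. 0}" "step_paths step 0"] by auto
  next
    case (Suc N)
    let ?E = "\<lambda>t. (\<lambda>v. t(Suc N := v)) ` step (t N)"
    have sub: "step_paths step (Suc N) \<subseteq> (\<Union>t\<in>step_paths step N. ?E t)"
    proof
      fix t assume t: "t \<in> step_paths step (Suc N)"
      let ?t = "t(Suc N := 0)"
      have "?t \<in> step_paths step N"
        using t by (auto simp: step_paths_def)
      moreover have "t = ?t(Suc N := t (Suc N))" "t (Suc N) \<in> step (?t N)"
        using t by (auto simp: step_paths_def)
      ultimately show "t \<in> (\<Union>t\<in>step_paths step N. ?E t)" by blast
    qed
    have fin: "finite (\<Union>t\<in>step_paths step N. ?E t)" using Suc assms by auto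
    have "card (step_paths step (Suc N)) \<le> card (\<Union>t\<in>step_paths step N. ?E t)"
      by (rule card_mono[OF fin sub])
    also have "\<dots> \<le> (\<Sum>t\<in>step_paths step N. card (?E t))"
      using Suc by (intro card_UN_le) auto
    also have "\<dots> \<le> (\<Sum>t\<in>step_paths step N. B)"
      using assms by (intro sum_mono) (meson card_image_le order_trans)
    also have "\<dots> \<le> B ^ N * B" using Suc by simp
    finally show ?case using finite_subset[OF sub fin] by (simp add: mult.commute)
  qed
  then show "finite (step_paths step N)" "card (step_paths step N) \<le> B ^ N" by auto
qed

text \<open>For equal increments \<open>P * (\<Sum>l<P. (\<delta> l)\<^sup>2)\<close> is just \<open>\<Delta>\<^sup>2\<close>; by the Cauchy-Schwarz inequality it grows at least
  by the square of the deviation of any partial sum from its proportional share.\<close>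

lemma square_sum_gain:
  fixes \<delta> :: "nat \<Rightarrow> real"
  assumes "0 < P" "s \<le> P"
  defines "\<Delta> \<equiv> \<Sum>l<P. \<delta> l"
  shows "\<Delta>\<^sup>2 + ((\<Sum>l<s. \<delta> l) - s / P * \<Delta>)\<^sup>2 \<le> P * (\<Sum>l<P. (\<delta> l)\<^sup>2)"
proof -
  \<comment> \<open>The deviations from the mean increment account for the whole surplus.\<close>
  define e where "e l = \<delta> l - \<Delta> / P" for l
  have "(\<Sum>l<P. (e l)\<^sup>2) = (\<Sum>l<P. (\<delta> l)\<^sup>2) - 2 * (\<Delta> / P) * (\<Sum>l<P. \<delta> l) + P * (\<Delta> / P)\<^sup>2"
    unfolding e_def by (simp add: power2_diff sum.distrib sum_subtractf sum_distrib_left sum_divide_distrib mult_ac)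
  then have "P * (\<Sum>l<P. (e l)\<^sup>2) = P * (\<Sum>l<P. (\<delta> l)\<^sup>2) - \<Delta>\<^sup>2"
    unfolding \<Delta>_def[symmetric] using assms(1) by (simp add: field_simps power2_eq_square)
  moreover have "((\<Sum>l<s. \<delta> l) - s / P * \<Delta>)\<^sup>2 \<le> P * (\<Sum>l<P. (e l)\<^sup>2)"
  proof -
    have "((\<Sum>l<s. \<delta> l) - s / P * \<Delta>)\<^sup>2 = (\<Sum>l<s. e l)\<^sup>2"
      by (simp add: e_def sum_subtractf)
    also have "\<dots> \<le> (\<Sum>l<s. (e l)\<^sup>2) * card {..<s}" by (rule sum_squared_le_sum_of_squares)
    also have "\<dots> \<le> (\<Sum>l<P. (e l)\<^sup>2) * P"
      using assms(2) by (intro mult_mono sum_mono2 sum_nonneg) auto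
    finally show ?thesis by (simp add: mult.commute)
  qed
  ultimately show ?thesis by linarith
qed

section \<open>Nested grids with marked points\<close>

text \<open>The grid of level \<open>j\<close> has \<open>(4 * p) ^ j\<close> cells, each divided into \<open>4 * p\<close> parts by the next grid. The
  mark of the cell \<open>i\<close> is the division point number \<open>s j i\<close>; it is taken from the middle half of the cell, so that it
  keeps a distance of a quarter of the cell from the ends.\<close>

locale nested_grid =
  fixes p :: nat and s :: "nat \<Rightarrow> nat \<Rightarrow> nat"
  assumes p_pos: "0 < p"
    and s_range: "i < (4 * p) ^ j \<Longrightarrow> p \<le> s j i \<and> s j i < 3 * p"
begin

definition P :: nat where "P = 4 * p"

lemma P_pos: "0 < P"
  using p_pos by (simp add: P_def)

text \<open>The points of the grid of level \<open>j\<close> and the marks in its cells, over the common denominator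
  \<open>P ^ (j + 1)\<close>.\<close>

definition numerators :: "nat \<Rightarrow> nat set" where
  "numerators j = {i * P | i. i \<le> P ^ j} \<union> {i * P + s j i | i. i < P ^ j}"

definition grid :: "nat \<Rightarrow> real set" where
  "grid j = (\<lambda>n. real n / real P ^ Suc j) ` numerators j"

text \<open>A point gets a quarter of the mesh of the coarsest marked grid that contains it.\<close>

definition grid_height :: "real \<Rightarrow> real" where
  "grid_height x = (if \<exists>j. x \<in> grid j then 1 / (4 * real P ^ (LEAST j. x \<in> grid j)) else 0)"

text \<open>Modulo \<open>P = 4 * p\<close> a numerator is \<open>0\<close> or lies between \<open>p\<close> and \<open>3 * p\<close>, and each multiple of \<open>P\<close> is
  followed by a single mark.\<close>

lemma numerators_separated:
  assumes "n \<in> numerators j" "m \<in> numerators j" "n < m"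
  shows "n + p \<le> m"
proof -
  have s: "p \<le> s j i \<and> s j i < 3 * p" if "i < P ^ j" for i
    using s_range that by (simp add: P_def)
  have *: "\<exists>i r. n = i * P + r \<and> (r = 0 \<or> (i < P ^ j \<and> r = s j i))" if n: "n \<in> numerators j" for n
  proof -
    consider i where "n = i * P + 0" | i where "i < P ^ j" "n = i * P + s j i"
      using n unfolding numerators_def by auto
    then show ?thesis by cases blast+
  qed
  obtain i r where n: "n = i * P + r" "r = 0 \<or> (i < P ^ j \<and> r = s j i)" using *[OF assms(1)] by blast
  obtain i' r' where m: "m = i' * P + r'" "r' = 0 \<or> (i' < P ^ j \<and> r' = s j i')" using *[OF assms(2)] by blast
  have r: "r < 3 * p" "r = 0 \<or> p \<le> r" using n(2) s[of i] p_pos by auto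
  have r': "r' < 3 * p" "r' = 0 \<or> p \<le> r'" using m(2) s[of i'] p_pos by auto
  have "i \<le> i'"
  proof (rule ccontr)
    assume "\<not> i \<le> i'"
    then have "Suc i' * P \<le> i * P" by (intro mult_right_mono) auto
    then show False using assms(3) n(1) m(1) r' by (simp add: P_def)
  qed
  show ?thesis
  proof (cases "i = i'")
    case True
    then show ?thesis using assms(3) n m r r' by auto
  next
    case False
    then have "Suc i * P \<le> i' * P" using \<open>i \<le> i'\<close> by (intro mult_right_mono) auto
    then show ?thesis using n(1) m(1) r by (simp add: P_def)
  qed
qed

lemma grid_separated:
  assumes "x \<in> grid j" "y \<in> grid j" "x \<noteq> y"
  shows "1 / (4 * real P ^ j) \<le> \<bar>x - y\<bar>"
proof -
  have "1 / (4 * real P ^ j) \<le> y - x" if xy: "x \<in> grid j" "y \<in> grid j" "x < y" for x y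
  proof -
    obtain n m where nm: "n \<in> numerators j" "m \<in> numerators j" "x = n / real P ^ Suc j" "y = m / real P ^ Suc j"
      using xy(1,2) unfolding grid_def by blast
    then have "n < m" using xy(3) P_pos by (simp add: divide_less_cancel)
    then have "real n + real p \<le> real m" using numerators_separated[OF nm(1,2)] by (simp flip: of_nat_add)
    then have "real p / real P ^ Suc j \<le> (real m - real n) / real P ^ Suc j"
      using P_pos by (intro divide_right_mono) auto
    moreover have "real p / real P ^ Suc j = 1 / (4 * real P ^ j)" using p_pos by (simp add: P_def)
    ultimately show ?thesis unfolding nm(3,4) by (simp add: diff_divide_distrib)
  qed
  from this[of x y] this[of y x] assms show ?thesis by (cases "x < y") auto
qed

lemma grid_points:
  assumes "i \<le> P ^ j"
  shows "real i / real P ^ j \<in> grid j"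
proof -
  have "real i / real P ^ j = real (i * P) / real P ^ Suc j" using P_pos by simp
  moreover have "i * P \<in> numerators j" using assms unfolding numerators_def by blast
  ultimately show ?thesis unfolding grid_def by (rule image_eqI)
qed

lemma grid_marked_points:
  assumes "i < P ^ j"
  shows "real (i * P + s j i) / real P ^ Suc j \<in> grid j"
proof -
  have "i * P + s j i \<in> numerators j" using assms unfolding numerators_def by blast
  then show ?thesis unfolding grid_def by (rule imageI)
qed

lemma grid_subset: "grid j \<subseteq> (\<lambda>i. real i / real P ^ Suc j) ` {..P ^ Suc j}"
proof -
  have "i * P + s j i \<le> P ^ Suc j" if "i < P ^ j" for i
  proof -
    have "i * P + s j i \<le> Suc i * P" using s_range[of i j] that by (simp add: P_def)
    also have "\<dots> \<le> P ^ j * P" using that by (intro mult_right_mono) auto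
    finally show ?thesis by (simp add: mult.commute)
  qed
  moreover have "i * P \<le> P ^ Suc j" if "i \<le> P ^ j" for i using that by (simp add: mult.commute)
  ultimately show ?thesis unfolding grid_def numerators_def by auto
qed

lemma grid_mono: "i \<le> j \<Longrightarrow> grid i \<subseteq> grid j"
proof (rule lift_Suc_mono_le[of grid])
  show "grid n \<subseteq> grid (Suc n)" for n
    using grid_subset[of n] grid_points[of _ "Suc n"] by blast
qed

lemma grid_height_ge:
  assumes "x \<in> grid j"
  shows "1 / (4 * real P ^ j) \<le> grid_height x"
proof -
  have "(LEAST j. x \<in> grid j) \<le> j" using assms by (rule Least_le)
  then have "real P ^ (LEAST j. x \<in> grid j) \<le> real P ^ j" using P_pos by (intro power_increasing) auto
  then show ?thesis using assms P_pos unfolding grid_height_def by (auto intro!: divide_left_mono)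
qed

lemma grid_height_bounds: "0 \<le> grid_height x" "grid_height x \<le> 1 / 4"
proof -
  show "0 \<le> grid_height x" by (simp add: grid_height_def)
  have "1 \<le> real P ^ n" for n using P_pos by (intro one_le_power) auto
  then have "1 / (4 * real P ^ n) \<le> 1 / (4 * 1)" for n by (intro divide_left_mono) (auto intro: mult_pos_pos P_pos)
  then show "grid_height x \<le> 1 / 4" by (simp add: grid_height_def)
qed

lemma grid_height_ends: "grid_height 0 = 1 / 4" "grid_height 1 = 1 / 4"
  using grid_height_ge[OF grid_points[of 0 0]] grid_height_ge[OF grid_points[of 1 0]]
    grid_height_bounds(2)[of 0] grid_height_bounds(2)[of 1] by auto

lemma grid_height_separated:
  assumes "x \<noteq> y"
  shows "min (grid_height x) (grid_height y) \<le> \<bar>x - y\<bar>"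
proof (cases "(\<exists>j. x \<in> grid j) \<and> (\<exists>j. y \<in> grid j)")
  case True
  define i j where "i = (LEAST j. x \<in> grid j)" and "j = (LEAST j. y \<in> grid j)"
  have x: "x \<in> grid i" "y \<in> grid j" using True LeastI_ex unfolding i_def j_def by metis+
  have h: "grid_height x = 1 / (4 * real P ^ i)" "grid_height y = 1 / (4 * real P ^ j)"
    using True unfolding grid_height_def i_def j_def by auto
  have "x \<in> grid (max i j)" "y \<in> grid (max i j)"
    using x grid_mono[of i "max i j"] grid_mono[of j "max i j"] by auto
  from grid_separated[OF this assms] show ?thesis
    unfolding h by (cases "i \<le> j") (auto simp: max_def min_le_iff_disj)
next
  case False
  then have "grid_height x = 0 \<or> grid_height y = 0" by (auto simp: grid_height_def)
  then show ?thesis by (auto simp: min_le_iff_disj)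
qed

end

section \<open>Opponents of the marks\<close>

definition increments_within :: "real \<Rightarrow> (real \<Rightarrow> real) \<Rightarrow> bool" where
  "increments_within k g \<longleftrightarrow> (\<forall>s t. 0 \<le> s \<longrightarrow> s \<le> t \<longrightarrow> t \<le> 1 \<longrightarrow> (t - s) / k \<le> g t - g s \<and> g t - g s \<le> k * (t - s))"

text \<open>The division points \<open>x\<close> of a cell at which a function with end values \<open>u\<close> and \<open>v\<close> can take a
  value in \<open>A\<close> that differs from the affine one by less than half of what the affine function gains
  from one division point to the next. Hence each element of \<open>A\<close> serves at most one \<open>x\<close>.\<close>

definition nearly_affine_choices :: "nat \<Rightarrow> real set \<Rightarrow> real \<Rightarrow> real \<Rightarrow> nat set" where
  "nearly_affine_choices p A u v =
     {x \<in> {p..<3 * p}. \<exists>q\<in>A \<inter> {u..v}. \<bar>q - (u + x / real (4 * p) * (v - u))\<bar> < (v - u) / (2 * real (4 * p))}"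

lemma card_nearly_affine_choices:
  assumes "finite (A \<inter> {u..v})" "0 < p"
  shows "card (nearly_affine_choices p A u v) \<le> card (A \<inter> {u..v})"
proof -
  let ?P = "real (4 * p)"
  have "\<forall>x\<in>nearly_affine_choices p A u v. \<exists>q. q \<in> A \<inter> {u..v} \<and> \<bar>q - (u + x / ?P * (v - u))\<bar> < (v - u) / (2 * ?P)"
    unfolding nearly_affine_choices_def by blast
  then obtain q where q: "\<And>x. x \<in> nearly_affine_choices p A u v \<Longrightarrow> q x \<in> A \<inter> {u..v}"
    "\<And>x. x \<in> nearly_affine_choices p A u v \<Longrightarrow> \<bar>q x - (u + x / ?P * (v - u))\<bar> < (v - u) / (2 * ?P)"
    by metis
  have "inj_on q (nearly_affine_choices p A u v)"
  proof (rule inj_onI)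
    fix x y assume xy: "x \<in> nearly_affine_choices p A u v" "y \<in> nearly_affine_choices p A u v" "q x = q y"
    have "\<bar>x / ?P * (v - u) - y / ?P * (v - u)\<bar> < (v - u) / ?P"
      using q(2)[OF xy(1)] q(2)[OF xy(2)] xy(3) by (simp add: abs_less_iff)
    moreover have "x / ?P * (v - u) - y / ?P * (v - u) = (real x - real y) * ((v - u) / ?P)"
      by (simp add: left_diff_distrib flip: diff_divide_distrib)
    ultimately have *: "\<bar>real x - real y\<bar> * \<bar>(v - u) / ?P\<bar> < (v - u) / ?P" by (simp add: abs_mult)
    moreover have "0 \<le> \<bar>real x - real y\<bar> * \<bar>(v - u) / ?P\<bar>" by simp
    ultimately have pos: "0 < (v - u) / ?P" by linarith
    then have "\<bar>real x - real y\<bar> * ((v - u) / ?P) < 1 * ((v - u) / ?P)" using * by (simp only: abs_of_pos mult_1)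
    then have "\<bar>real x - real y\<bar> < 1" by (rule mult_right_less_imp_less) (use pos in simp)
    then show "x = y" by linarith
  qed
  then show ?thesis using card_inj_on_le[of q] q(1) assms(1) by blast
qed

text \<open>The positions on a segment of the branch points of height at least \<open>r\<close>, in abstract form.\<close>

definition separated_family :: "real \<Rightarrow> (real \<Rightarrow> real set) \<Rightarrow> bool" where
  "separated_family \<sigma> X \<longleftrightarrow> (\<forall>r>0. \<forall>x\<in>X r. \<forall>y\<in>X r. x \<noteq> y \<longrightarrow> \<sigma> * r \<le> \<bar>x - y\<bar>) \<and>
     (\<forall>r r'. 0 < r \<longrightarrow> r \<le> r' \<longrightarrow> X r' \<subseteq> X r)"

text \<open>Both the length of the interval and the separation are proportional to the mesh \<open>1 / N\<close>, so the
  bound does not depend on the level.\<close>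

lemma separated_family_count:
  fixes N :: nat
  assumes X: "separated_family \<sigma> X" and "0 < \<sigma>" "0 < k" "0 < N"
  shows "finite (X (1 / (4 * N)) \<inter> {v..v + k / N})" 
    "card (X (1 / (4 * N)) \<inter> {v..v + k / N}) \<le> nat \<lfloor>4 * k / \<sigma>\<rfloor> + 1"
proof -
  let ?A = "X (1 / (4 * N)) \<inter> {v..v + k / N}"
  have "(1::real) / (4 * N) > 0" using assms(4) by simp
  then have sep: "\<sigma> * (1 / (4 * N)) \<le> \<bar>x - y\<bar>" if "x \<in> ?A" "y \<in> ?A" "x \<noteq> y" for x y
    using X that unfolding separated_family_def by blast
  have pos: "\<sigma> * (1 / (4 * N)) > 0" using assms by simp
  have sub: "?A \<subseteq> {v..v + k / N}" by blast
  have eq: "k / N / (\<sigma> * (1 / (4 * N))) = 4 * k / \<sigma>" using assms by (simp add: field_simps)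
  show "finite ?A" by (rule card_separated_le(1)[OF sep pos sub])
  show "card ?A \<le> nat \<lfloor>4 * k / \<sigma>\<rfloor> + 1"
    using card_separated_le(2)[OF sep pos sub] unfolding eq .
qed

text \<open>The opponents are the pairs of a family \<open>X\<close> and a list of values on the grid that is possible for
  a \<open>k\<close>-Lipschitz function with values in \<open>X\<close>. The bound \<open>B\<close> does not involve \<open>p\<close>, and \<open>p\<close> is just large enough
  for \<open>choice_hitting_at_most_half\<close> with \<open>z = 2 * B + card \<X> + 1\<close>.\<close>

lemma marks_defeating_tuples:
  fixes k \<sigma> :: real and j :: nat
  assumes \<X>: "finite \<X>" "\<And>X. X \<in> \<X> \<Longrightarrow> separated_family \<sigma> X" and pos: "0 < \<sigma>" "0 < k"
  defines "B \<equiv> nat \<lfloor>4 * k / \<sigma>\<rfloor> + 1"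
  defines "p \<equiv> B * (2 * B + card \<X> + 1)\<^sup>2"
  defines "N \<equiv> (4 * p) ^ j"
  shows "\<exists>s. (\<forall>i<N. p \<le> s i \<and> s i < 3 * p) \<and>
     (\<forall>X\<in>\<X>. \<forall>t\<in>step_paths (\<lambda>v. X (1 / (4 * N)) \<inter> {v..v + k / N}) N.
        2 * card {i. i < N \<and> s i \<in> nearly_affine_choices p (X (1 / (4 * N))) (t i) (t (Suc i))} \<le> N)"
proof -
  have "0 < p" by (simp add: p_def B_def)
  then have "0 < N" by (simp add: N_def)
  define step where "step X v = X (1 / (4 * N)) \<inter> {v..v + k / N}" for X v
  have step: "finite (step X v) \<and> card (step X v) \<le> B" if "X \<in> \<X>" for X v
    unfolding step_def B_def using separated_family_count[OF \<X>(2)[OF that] pos \<open>0 < N\<close>] by blast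
  define W where "W = Sigma \<X> (\<lambda>X. step_paths (step X) N)"
  have "finite W" unfolding W_def using \<X>(1) card_step_paths(1) step by blast
  have "card W = (\<Sum>X\<in>\<X>. card (step_paths (step X) N))"
    unfolding W_def using \<X>(1) card_step_paths(1) step by (intro card_SigmaI) blast+
  also have "\<dots> \<le> (\<Sum>X\<in>\<X>. B ^ N)"
    by (intro sum_mono card_step_paths(2)) (use step in blast)
  finally have cardW: "card W \<le> card \<X> * B ^ N" by simp
  define G where "G i w = (case w of (X, t) \<Rightarrow> nearly_affine_choices p (X (1 / (4 * N))) (t i) (t (Suc i)))"
    for i and w :: "(real \<Rightarrow> real set) \<times> (nat \<Rightarrow> real)"
  define z where "z = real (2 * B + card \<X> + 1)"
  have G: "G i w \<subseteq> {p..<3 * p} \<and> card (G i w) * z\<^sup>2 \<le> card {p..<3 * p}" if iw: "i < N" "w \<in> W" for i w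
  proof -
    obtain X t where w: "w = (X, t)" "X \<in> \<X>" "t \<in> step_paths (step X) N" using iw(2) unfolding W_def by blast
    let ?A = "X (1 / (4 * N))"
    have "t (Suc i) \<in> step X (t i)" using w(3) iw(1) unfolding step_paths_def by blast
    then have sub: "?A \<inter> {t i..t (Suc i)} \<subseteq> step X (t i)" unfolding step_def by auto
    have fin: "finite (?A \<inter> {t i..t (Suc i)})" using finite_subset[OF sub] step[OF w(2)] by blast
    have "card (G i w) \<le> card (?A \<inter> {t i..t (Suc i)})"
      unfolding G_def w(1) using card_nearly_affine_choices[OF fin \<open>0 < p\<close>] by simp
    also have "\<dots> \<le> card (step X (t i))" using card_mono[OF _ sub] step[OF w(2)] by blast
    also have "\<dots> \<le> B" using step[OF w(2)] by blast
    finally have "real (card (G i w)) * z\<^sup>2 \<le> real B * z\<^sup>2" by (intro mult_right_mono) auto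
    also have "\<dots> = real p" by (simp add: p_def z_def)
    also have "\<dots> \<le> card {p..<3 * p}" by simp
    finally show ?thesis unfolding G_def w(1) nearly_affine_choices_def by auto
  qed
  have "\<exists>s. (\<forall>i<N. s i \<in> {p..<3 * p}) \<and> (\<forall>w\<in>W. 2 * card {i. i < N \<and> s i \<in> G i w} \<le> N)"
    by (rule choice_hitting_at_most_half[OF \<open>finite W\<close> cardW, where z = z])
      (use G \<open>0 < p\<close> in \<open>auto simp: z_def\<close>)
  then obtain s where s: "\<And>i. i < N \<Longrightarrow> s i \<in> {p..<3 * p}" "\<And>w. w \<in> W \<Longrightarrow> 2 * card {i. i < N \<and> s i \<in> G i w} \<le> N"
    by blast
  have "2 * card {i. i < N \<and> s i \<in> nearly_affine_choices p (X (1 / (4 * N))) (t i) (t (Suc i))} \<le> N"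
    if "X \<in> \<X>" "t \<in> step_paths (\<lambda>v. X (1 / (4 * N)) \<inter> {v..v + k / N}) N" for X t
    using s(2)[of "(X, t)"] that by (simp add: W_def G_def step_def[abs_def])
  then show ?thesis using s(1) by (intro exI[of _ s]) auto
qed

section \<open>Energy\<close>

context nested_grid
begin

lemma grid_increment:
  assumes g: "increments_within k g" and k: "0 < k" and i: "i < P ^ j"
  defines "D \<equiv> g (real (Suc i) / real P ^ j) - g (real i / real P ^ j)"
  shows "1 / real P ^ j / k \<le> D" and "D \<le> k / real P ^ j" and "0 \<le> D"
proof -
  let ?N = "real P ^ j"
  have N: "?N > 0" using P_pos by simp
  have "real (Suc i) \<le> ?N" using of_nat_mono[of "Suc i" "P ^ j", where 'a = real] i by simp
  then have "real (Suc i) / ?N \<le> 1" "0 \<le> real i / ?N" "real i / ?N \<le> real (Suc i) / ?N"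
    using N by (auto intro: divide_right_mono)
  then have *: "(real (Suc i) / ?N - real i / ?N) / k \<le> D" "D \<le> k * (real (Suc i) / ?N - real i / ?N)"
    using g unfolding increments_within_def D_def by blast+
  have d: "real (Suc i) / ?N - real i / ?N = 1 / ?N" by (simp add: add_divide_distrib)
  show 1: "1 / ?N / k \<le> D" and "D \<le> k / ?N" using * unfolding d by simp_all
  have "0 \<le> 1 / ?N / k" using N k by simp
  then show "0 \<le> D" using 1 by linarith
qed

text \<open>The integral of the squared slope of the function that interpolates \<open>g\<close> on the grid of level \<open>j\<close>.\<close>

definition energy :: "(real \<Rightarrow> real) \<Rightarrow> nat \<Rightarrow> real" where
  "energy g j = real P ^ j * (\<Sum>i<P ^ j. (g (real (Suc i) / real P ^ j) - g (real i / real P ^ j))\<^sup>2)"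

lemma energy_le:
  assumes g: "increments_within k g" and "0 < k"
  shows "energy g j \<le> k\<^sup>2"
proof -
  let ?N = "real P ^ j"
  have N: "?N > 0" using P_pos by simp
  have "(g (real (Suc i) / ?N) - g (real i / ?N))\<^sup>2 \<le> (k / ?N)\<^sup>2" if "i < P ^ j" for i
    using grid_increment(2,3)[OF g \<open>0 < k\<close> that] by (intro power_mono)
  then have "energy g j \<le> ?N * (\<Sum>i<P ^ j. (k / ?N)\<^sup>2)"
    unfolding energy_def by (intro mult_left_mono sum_mono) auto
  also have "\<dots> = k\<^sup>2" using P_pos by (simp add: power2_eq_square)
  finally show ?thesis .
qed

text \<open>In every cell that is not counted in \<open>few\<close> the value at the mark deviates from the affine one by at least
  \<open>1 / (2 * P)\<close> of the increment, which is at least \<open>1 / (k * P ^ j)\<close>. By \<open>square_sum_gain\<close> the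
  cell then gains the square of this deviation, and there are at least \<open>P ^ j / 2\<close> such cells.\<close>

lemma energy_gain:
  assumes g: "increments_within k g" and "0 < k"
    and few: "2 * card {i. i < P ^ j \<and> s j i \<in> 
       nearly_affine_choices p A (g (real i / real P ^ j)) (g (real (Suc i) / real P ^ j))} \<le> P ^ j"
    and A: "\<And>i. i < P ^ j \<Longrightarrow> g (real (i * P + s j i) / real P ^ Suc j) \<in> A"
  shows "energy g j + 1 / (8 * k\<^sup>2 * (real P)\<^sup>2) \<le> energy g (Suc j)"
proof -
  let ?N = "real P ^ j"
  define x where "x m = real m / real P ^ Suc j" for m :: nat
  define D where "D i = g (real (Suc i) / ?N) - g (real i / ?N)" for i :: nat
  define \<delta> where "\<delta> m = g (x (Suc m)) - g (x m)" for m :: nat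
  define H where "H = {i. i < P ^ j \<and> s j i \<in> nearly_affine_choices p A (g (real i / ?N)) (g (real (Suc i) / ?N))}"
  have N: "?N > 0" using P_pos by simp
  have x_block: "x (i * P) = real i / ?N" for i using P_pos by (simp add: x_def)
  have tele: "(\<Sum>l<m. \<delta> (i * P + l)) = g (x (i * P + m)) - g (real i / ?N)" for i m
    by (induction m) (simp_all add: \<delta>_def x_block)
  have mono: "g a \<le> g b" if "0 \<le> a" "a \<le> b" "b \<le> 1" for a b
  proof -
    have "(b - a) / k \<le> g b - g a" using g that unfolding increments_within_def by blast
    moreover have "0 \<le> (b - a) / k" using that \<open>0 < k\<close> by simp
    ultimately show ?thesis by simp
  qed
  define gain where "gain i = (if i \<in> H then 0 else 1 / (4 * k\<^sup>2 * (real P)\<^sup>2 * ?N\<^sup>2))" for i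
  have block: "(D i)\<^sup>2 + gain i \<le> P * (\<Sum>l<P. (\<delta> (i * P + l))\<^sup>2)" if i: "i < P ^ j" for i
  proof -
    have s: "p \<le> s j i" "s j i < 3 * p" using s_range i by (auto simp: P_def)
    then have sP: "s j i \<le> P" by (simp add: P_def)
    have iN: "real (Suc i) \<le> ?N" using i by (metis Suc_leI of_nat_le_iff of_nat_power)
    have sum: "(\<Sum>l<P. \<delta> (i * P + l)) = D i"
      using x_block[of "Suc i"] unfolding tele D_def by (simp add: add.commute)
    let ?y = "x (i * P + s j i)"
    let ?dev = "(\<Sum>l<s j i. \<delta> (i * P + l)) - s j i / P * D i"
    have main: "(D i)\<^sup>2 + ?dev\<^sup>2 \<le> P * (\<Sum>l<P. (\<delta> (i * P + l))\<^sup>2)"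
      using square_sum_gain[OF P_pos sP, of "\<lambda>l. \<delta> (i * P + l)"] unfolding sum .
    have "gain i \<le> ?dev\<^sup>2"
    proof (cases "i \<in> H")
      case False
      have "real i / ?N \<le> ?y"
        unfolding x_block[symmetric] x_def by (intro divide_right_mono of_nat_mono) auto
      moreover have "?y \<le> real (Suc i) / ?N"
        unfolding x_block[symmetric] x_def using sP by (intro divide_right_mono of_nat_mono) auto
      ultimately have ends: "0 \<le> real i / ?N" "real i / ?N \<le> ?y" "?y \<le> real (Suc i) / ?N" "real (Suc i) / ?N \<le> 1"
        using iN N by auto
      have "g ?y \<in> A \<inter> {g (real i / ?N)..g (real (Suc i) / ?N)}"
        using A[OF i] mono[OF ends(1,2)] mono[of ?y "real (Suc i) / ?N"] ends by (auto simp: x_def)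
      then have "D i / (2 * real P) \<le> \<bar>g ?y - (g (real i / ?N) + s j i / real P * D i)\<bar>"
        using False i s unfolding H_def nearly_affine_choices_def D_def P_def[symmetric] by (auto simp: not_less)
      also have "\<dots> = \<bar>?dev\<bar>" unfolding tele by (simp add: algebra_simps)
      finally have dev: "D i / (2 * real P) \<le> \<bar>?dev\<bar>" .
      have "1 / ?N / k \<le> D i" unfolding D_def by (rule grid_increment(1)[OF g \<open>0 < k\<close> i])
      then have "1 / ?N / k / (2 * real P) \<le> D i / (2 * real P)" by (intro divide_right_mono) auto
      then have "1 / ?N / k / (2 * real P) \<le> \<bar>?dev\<bar>" using dev by linarith
      then have "(1 / ?N / k / (2 * real P))\<^sup>2 \<le> \<bar>?dev\<bar>\<^sup>2"
        using N \<open>0 < k\<close> by (intro power_mono) auto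
      moreover have "gain i = (1 / ?N / k / (2 * real P))\<^sup>2"
        using False by (simp add: gain_def power_divide power_mult_distrib mult_ac)
      ultimately show ?thesis by simp
    qed (simp add: gain_def)
    then show ?thesis using main by linarith
  qed
  have "energy g j + ?N * (\<Sum>i<P ^ j. gain i) = ?N * (\<Sum>i<P ^ j. (D i)\<^sup>2 + gain i)"
    by (simp add: energy_def D_def sum.distrib distrib_left)
  also have "\<dots> \<le> ?N * (\<Sum>i<P ^ j. P * (\<Sum>l<P. (\<delta> (i * P + l))\<^sup>2))"
    using N block by (intro mult_left_mono sum_mono) auto
  also have "\<dots> = real P ^ Suc j * (\<Sum>i<P ^ j. \<Sum>l<P. (\<delta> (i * P + l))\<^sup>2)"
    by (simp add: sum_distrib_left mult_ac)
  also have "(\<Sum>i<P ^ j. \<Sum>l<P. (\<delta> (i * P + l))\<^sup>2) = (\<Sum>m<P ^ j * P. (\<delta> m)\<^sup>2)"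
  proof -
    have "(\<Sum>l<P. (\<delta> (i * P + l))\<^sup>2) = (\<Sum>m = i * P..<i * P + P. (\<delta> m)\<^sup>2)" for i
      using sum.shift_bounds_nat_ivl[of "\<lambda>m. (\<delta> m)\<^sup>2" 0 "i * P" P] by (simp add: lessThan_atLeast0 add.commute)
    then show ?thesis using sum.nat_group[of "\<lambda>m. (\<delta> m)\<^sup>2" P "P ^ j"] by simp
  qed
  also have "real P ^ Suc j * (\<Sum>m<P ^ j * P. (\<delta> m)\<^sup>2) = energy g (Suc j)"
    by (simp add: energy_def \<delta>_def x_def mult.commute)
  finally have 1: "energy g j + ?N * (\<Sum>i<P ^ j. gain i) \<le> energy g (Suc j)" .
  let ?c = "1 / (4 * k\<^sup>2 * (real P)\<^sup>2 * ?N\<^sup>2)"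
  have "(\<Sum>i<P ^ j. gain i) = (\<Sum>i\<in>{..<P ^ j} - H. ?c)"
    unfolding gain_def by (subst sum.If_cases) (auto simp: Diff_eq)
  also have "\<dots> = real (P ^ j - card H) * ?c"
    by (simp add: card_Diff_subset H_def subset_eq)
  also have "\<dots> \<ge> (?N / 2) * ?c"
  proof (rule mult_right_mono)
    have "2 * card H \<le> P ^ j" using few unfolding H_def .
    then have "P ^ j \<le> 2 * (P ^ j - card H)" by linarith
    then have "real (P ^ j) \<le> real (2 * (P ^ j - card H))" by (rule of_nat_mono)
    then show "?N / 2 \<le> real (P ^ j - card H)" by simp
  qed simp
  finally have "?N * ((?N / 2) * ?c) \<le> ?N * (\<Sum>i<P ^ j. gain i)" using N by (intro mult_left_mono) auto
  moreover have "?N * ((?N / 2) * ?c) = 1 / (8 * k\<^sup>2 * (real P)\<^sup>2)" using N by (simp add: power2_eq_square)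
  ultimately show ?thesis using 1 by linarith
qed

end

text \<open>With the marks of \<open>marks_defeating_tuples\<close> on all levels, a function \<open>g\<close> that obeys one of the
  families would gain the same amount of energy on each level, against the bound \<open>k\<^sup>2\<close>.\<close>

lemma heights_defeating_bilipschitz_maps:
  fixes k \<sigma> :: real
  assumes \<X>: "finite \<X>" "\<And>X. X \<in> \<X> \<Longrightarrow> separated_family \<sigma> X" and pos: "0 < \<sigma>" "0 < k"
  shows "\<exists>h. (\<forall>x. 0 \<le> h x \<and> h x \<le> 1 / 4) \<and> h 0 = 1 / 4 \<and> h 1 = 1 / 4 \<and>
     (\<forall>x y. x \<noteq> y \<longrightarrow> min (h x) (h y) \<le> \<bar>x - y\<bar>) \<and>
     (\<forall>X\<in>\<X>. \<nexists>g. g 0 = 0 \<and> increments_within k g \<and> (\<forall>x\<in>{0..1}. 0 < h x \<longrightarrow> g x \<in> X (h x)))"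
proof -
  define B where "B = nat \<lfloor>4 * k / \<sigma>\<rfloor> + 1"
  define p where "p = B * (2 * B + card \<X> + 1)\<^sup>2"
  define Q where "Q j s \<longleftrightarrow> (\<forall>i<(4 * p) ^ j. p \<le> s i \<and> s i < 3 * p) \<and>
     (\<forall>X\<in>\<X>. \<forall>t\<in>step_paths (\<lambda>v. X (1 / (4 * real ((4 * p) ^ j))) \<inter> {v..v + k / real ((4 * p) ^ j)}) ((4 * p) ^ j).
        2 * card {i. i < (4 * p) ^ j \<and> s i \<in> nearly_affine_choices p (X (1 / (4 * real ((4 * p) ^ j)))) (t i) (t (Suc i))}
          \<le> (4 * p) ^ j)" for j s
  have "\<exists>s. Q j s" for j
    unfolding Q_def p_def B_def by (rule marks_defeating_tuples[OF \<X> pos])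
  then obtain s where s: "\<And>j. Q j (s j)" by metis
  interpret nested_grid p s
  proof
    show "0 < p" by (simp add: p_def B_def)
    show "p \<le> s j i \<and> s j i < 3 * p" if "i < (4 * p) ^ j" for i j
      using s[of j] that unfolding Q_def by blast
  qed
  have False if X: "X \<in> \<X>" and g0: "g 0 = 0" and g: "increments_within k g"
      and gX: "\<And>x. x \<in> {0..1} \<Longrightarrow> 0 < grid_height x \<Longrightarrow> g x \<in> X (grid_height x)" for X g
  proof -
    let ?r = "\<lambda>j. 1 / (4 * real (P ^ j))"
    have on_grid: "g x \<in> X (?r j)" if xg: "x \<in> grid j" for x j
    proof -
      have "?r j > 0" using P_pos by simp
      moreover have "?r j \<le> grid_height x" using grid_height_ge[OF xg] by simp
      moreover have "x \<in> {0..1}"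
      proof -
        obtain n where n: "n \<le> P ^ Suc j" "x = real n / real P ^ Suc j" using xg grid_subset[of j] by blast
        have "real n \<le> real P ^ Suc j" using of_nat_mono[OF n(1), where 'a = real] by simp
        then show ?thesis using P_pos unfolding n(2) by simp
      qed
      ultimately show ?thesis
        using gX[of x] \<X>(2)[OF X] unfolding separated_family_def by (meson less_le_trans subsetD)
    qed
    have gain: "energy g j + 1 / (8 * k\<^sup>2 * (real P)\<^sup>2) \<le> energy g (Suc j)" for j
    proof (rule energy_gain[OF g pos(2), where A = "X (?r j)"])
      define t where "t i = (if i \<le> P ^ j then g (real i / real P ^ j) else 0)" for i
      have "t \<in> step_paths (\<lambda>v. X (?r j) \<inter> {v..v + k / real (P ^ j)}) (P ^ j)"
      proof -
        have "t (Suc i) \<in> X (?r j) \<inter> {t i..t i + k / real (P ^ j)}" if i: "i < P ^ j" for i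
        proof -
          have "g (real (Suc i) / real P ^ j) \<in> X (?r j)"
            using i by (intro on_grid grid_points) simp
          then show ?thesis
            using grid_increment(2,3)[OF g pos(2) i] i by (simp add: t_def)
        qed
        then show ?thesis unfolding step_paths_def by (auto simp: t_def g0)
      qed
      then have "2 * card {i. i < P ^ j \<and> s j i \<in> nearly_affine_choices p (X (?r j)) (t i) (t (Suc i))} \<le> P ^ j"
        using s[of j] X unfolding Q_def P_def by blast
      also have "{i. i < P ^ j \<and> s j i \<in> nearly_affine_choices p (X (?r j)) (t i) (t (Suc i))}
        = {i. i < P ^ j \<and> s j i \<in> nearly_affine_choices p (X (?r j)) (g (real i / real P ^ j)) (g (real (Suc i) / real P ^ j))}"
        by (auto simp: t_def)
      finally show "2 * card \<dots> \<le> P ^ j" .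
      show "g (real (i * P + s j i) / real P ^ Suc j) \<in> X (?r j)" if "i < P ^ j" for i
        by (rule on_grid[OF grid_marked_points[OF that]])
    qed
    let ?\<epsilon> = "1 / (8 * k\<^sup>2 * (real P)\<^sup>2)"
    have "real j * ?\<epsilon> \<le> energy g j" for j
    proof (induction j)
      case (Suc j)
      have "real (Suc j) * ?\<epsilon> = real j * ?\<epsilon> + ?\<epsilon>" by (simp add: add_divide_distrib)
      then show ?case using Suc gain[of j] by linarith
    qed (simp add: energy_def)
    then have "real j * ?\<epsilon> \<le> k\<^sup>2" for j using energy_le[OF g pos(2), of j] by (meson order_trans)
    moreover have "?\<epsilon> > 0" using pos P_pos by simp
    ultimately show False using reals_Archimedean3[of ?\<epsilon>] by (meson not_less)
  qed
  then have "\<nexists>g. g 0 = 0 \<and> increments_within k g \<and> (\<forall>x\<in>{0..1}. 0 < grid_height x \<longrightarrow> g x \<in> X (grid_height x))"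
    if "X \<in> \<X>" for X using that by meson
  then show ?thesis
    by (intro exI[of _ grid_height] conjI allI ballI impI grid_height_bounds grid_height_ends grid_height_separated) auto
qed

section \<open>Embeddings of combs\<close>

lemma embedding_preserves_between:
  assumes T: "geodesic_space T" and U: "geodesic_tree U"
    and f: "continuous_map (mtopology_of T) (mtopology_of U) f" "inj_on f (mspace T)"
    and xyz: "x \<in> mspace T" "y \<in> mspace T" "z \<in> mspace T" "mdist T x z + mdist T z y = mdist T x y"
  shows "mdist U (f x) (f z) + mdist U (f z) (f y) = mdist U (f x) (f y)"
proof -
  obtain \<gamma> where \<gamma>: "geodesic_from T \<gamma> x y" "\<gamma> (mdist T x z) = z"
    by (rule geodesic_through[OF T xyz])
  let ?D = "mdist T x y"
  have iso: "\<gamma> s \<in> mspace T" "mdist T (\<gamma> s) (\<gamma> t) = \<bar>s - t\<bar>" if "s \<in> {0..?D}" "t \<in> {0..?D}" for s t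
    using \<gamma>(1) that unfolding geodesic_from_def by blast+
  have inj: "inj_on (f \<circ> \<gamma>) {0..?D}"
  proof (rule inj_onI)
    fix s t assume st: "s \<in> {0..?D}" "t \<in> {0..?D}" "(f \<circ> \<gamma>) s = (f \<circ> \<gamma>) t"
    then have "\<gamma> s = \<gamma> t" using inj_onD[OF f(2)] iso(1)[OF st(1,1)] iso(1)[OF st(2,2)] by simp
    then have "\<bar>s - t\<bar> = 0" using iso(2)[OF st(1,2)] iso(1)[OF st(2,2)] by (metis mdist_zero)
    then show "s = t" by simp
  qed
  have cont: "continuous_map (top_of_set {0..?D}) (mtopology_of U) (f \<circ> \<gamma>)"
    by (rule continuous_map_compose[OF continuous_map_geodesic[OF \<gamma>(1)] f(1)])
  have "mdist T x z \<le> ?D" using xyz(4) mdist_nonneg[of T z y] by linarith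
  then have "mdist U ((f \<circ> \<gamma>) 0) ((f \<circ> \<gamma>) (mdist T x z)) + mdist U ((f \<circ> \<gamma>) (mdist T x z)) ((f \<circ> \<gamma>) ?D)
    = mdist U ((f \<circ> \<gamma>) 0) ((f \<circ> \<gamma>) ?D)"
    by (intro geodesic_tree_injective_path_between[OF U cont inj]) auto
  then show ?thesis using \<gamma> by (simp add: geodesic_from_def)
qed

definition bilipschitz_with :: "real \<Rightarrow> 'a metric \<Rightarrow> 'b metric \<Rightarrow> ('a \<Rightarrow> 'b) \<Rightarrow> bool" where
  "bilipschitz_with k M N f \<longleftrightarrow> f \<in> mspace M \<rightarrow> mspace N \<and>
     (\<forall>x\<in>mspace M. \<forall>y\<in>mspace M. mdist M x y / k \<le> mdist N (f x) (f y) \<and> mdist N (f x) (f y) \<le> k * mdist M x y)"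

lemma bilipschitz_with_imp_continuous_inj:
  assumes f: "bilipschitz_with k M N f" and "0 < k"
  shows "continuous_map (mtopology_of M) (mtopology_of N) f" "inj_on f (mspace M)"
proof -
  have "Lipschitz_continuous_map M N f"
    using f unfolding bilipschitz_with_def Lipschitz_continuous_map_def by blast
  then show "continuous_map (mtopology_of M) (mtopology_of N) f"
    by (rule Lipschitz_continuous_imp_continuous_map)
  show "inj_on f (mspace M)"
  proof (rule inj_onI)
    fix x y assume xy: "x \<in> mspace M" "y \<in> mspace M" "f x = f y"
    then have "f y \<in> mspace N" "mdist M x y / k \<le> mdist N (f x) (f y)"
      using f unfolding bilipschitz_with_def by blast+
    moreover have "mdist N (f x) (f y) = 0" using calculation(1) xy(3) by simp
    ultimately have "mdist M x y / k \<le> 0" by linarith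
    then have "mdist M x y \<le> 0" using \<open>0 < k\<close> by (simp add: divide_le_0_iff)
    then have "mdist M x y = 0" using mdist_nonneg[of M x y] by linarith
    then show "x = y" using xy by simp
  qed
qed

lemma bilipschitz_embedding_nat_constant:
  assumes "bilipschitz_embedding M N f"
  shows "\<exists>m. bilipschitz_with (real (Suc m)) M N f"
proof -
  obtain k K where f: "f \<in> mspace M \<rightarrow> mspace N" and kK: "k > 0" "K > 0" and
    *: "\<And>x y. x \<in> mspace M \<Longrightarrow> y \<in> mspace M \<Longrightarrow> 1 / k * mdist M x y \<le> mdist N (f x) (f y) \<and> mdist N (f x) (f y) \<le> K * mdist M x y"
    using assms unfolding bilipschitz_embedding_def by blast
  obtain m :: nat where m: "max k K \<le> real m" using real_arch_simple by blast
  have "mdist M x y / real (Suc m) \<le> mdist N (f x) (f y) \<and> mdist N (f x) (f y) \<le> real (Suc m) * mdist M x y"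
    if "x \<in> mspace M" "y \<in> mspace M" for x y
  proof
    have "mdist M x y / real (Suc m) \<le> mdist M x y / k"
      using m kK by (intro divide_left_mono) auto
    then show "mdist M x y / real (Suc m) \<le> mdist N (f x) (f y)" using *[OF that] by simp
    have "K * mdist M x y \<le> real (Suc m) * mdist M x y"
      using m by (intro mult_right_mono) auto
    then show "mdist N (f x) (f y) \<le> real (Suc m) * mdist M x y" using *[OF that] by linarith
  qed
  then show ?thesis using f unfolding bilipschitz_with_def by blast
qed

definition high_branch_points :: "'a metric \<Rightarrow> real \<Rightarrow> 'a set" where
  "high_branch_points U r = {q \<in> branch_points U. r \<le> height U q}"

lemma high_branch_points_separated:
  assumes U: "U \<in> GT n c" and c: "0 < c"
    and pq: "p \<in> high_branch_points U r" "q \<in> high_branch_points U r" "p \<noteq> q"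
  shows "c * r \<le> mdist U p q"
proof -
  have "c * r \<le> c * min (height U p) (height U q)"
    using pq c by (intro mult_left_mono) (auto simp: high_branch_points_def)
  also have "\<dots> \<le> mdist U p q"
    using U pq unfolding GT_def high_branch_points_def by blast
  finally show ?thesis .
qed

text \<open>They are \<open>c * r\<close>-separated in a compact space.\<close>

lemma finite_high_branch_points:
  assumes U: "U \<in> GT n c" and c: "0 < c" and r: "0 < r"
  shows "finite (high_branch_points U r)"
proof -
  interpret Metric_space "mspace U" "mdist U" by simp
  have "compact_space mtopology"
    using U unfolding GT_def geodesic_tree_def metric_tree_def mtopology_of_def by blast
  then have "mtotally_bounded (mspace U)" using compact_space_eq_mcomplete_mtotally_bounded by blast
  then have "\<exists>K. finite K \<and> K \<subseteq> mspace U \<and> mspace U \<subseteq> (\<Union>x\<in>K. mball x (c * r / 2))"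
    unfolding mtotally_bounded_def using c r by (elim allE[of _ "c * r / 2"]) simp
  then obtain K where K: "finite K" "mspace U \<subseteq> (\<Union>x\<in>K. mball x (c * r / 2))"
    by (elim exE conjE) (rule that)
  have EU: "high_branch_points U r \<subseteq> mspace U" by (auto simp: high_branch_points_def branch_points_def)
  have "\<forall>q\<in>high_branch_points U r. \<exists>x\<in>K. q \<in> mball x (c * r / 2)"
  proof
    fix q assume "q \<in> high_branch_points U r"
    then have "q \<in> (\<Union>x\<in>K. mball x (c * r / 2))" using EU K(2) by (meson subsetD)
    then show "\<exists>x\<in>K. q \<in> mball x (c * r / 2)" by (simp only: UN_iff)
  qed
  then obtain g where g: "\<And>q. q \<in> high_branch_points U r \<Longrightarrow> g q \<in> K \<and> q \<in> mball (g q) (c * r / 2)" by metis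
  have "inj_on g (high_branch_points U r)"
  proof (rule inj_onI, rule ccontr)
    fix p q assume pq: "p \<in> high_branch_points U r" "q \<in> high_branch_points U r" "g p = g q" "p \<noteq> q"
    have gp: "g p \<in> mspace U" "p \<in> mspace U" "q \<in> mspace U" "mdist U (g p) p < c * r / 2" "mdist U (g p) q < c * r / 2"
      using g[OF pq(1)] g[OF pq(2)] pq(3) by auto
    have "mdist U p q \<le> mdist U p (g p) + mdist U (g p) q" by (rule mdist_triangle[OF gp(2,1,3)])
    then have "mdist U p q < c * r" using gp(4,5) by (simp add: mdist_commute[of U p])
    then show False using high_branch_points_separated[OF U c pq(1,2,4)] by simp
  qed
  then show ?thesis using inj_on_finite[of g _ K] g K(1) by blast
qed

lemma GT_finite_branches:
  assumes "U \<in> GT n c" "q \<in> mspace U"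
  shows "finite (branches U q)"
proof -
  have "valence U q \<le> Val U" unfolding Val_def by (rule SUP_upper[OF assms(2)])
  also have "\<dots> \<le> enat n" using assms(1) by (simp add: GT_def)
  finally show ?thesis by (auto simp: valence_def split: if_splits)
qed

text \<open>From a foot \<open>(a, 0)\<close> three arms of length \<open>h a\<close> issue, and the foot lies between any two points on
  different arms; this persists in \<open>U\<close>, where the images of the arms are therefore in
  different branches. The arms are cut off at half their length to be away from the foot; the
  outer halves still have diameter \<open>h a / 2\<close>.\<close>

lemma (in comb_heights) foot_image_high_branch_point:
  assumes U: "U \<in> GT n c" and f: "bilipschitz_with k (comb h) U f" "0 < k" and a: "0 < h a"
  shows "f (plane_code (a, 0)) \<in> high_branch_points U (h a / (2 * k))"
proof -
  have tree: "geodesic_tree U" using U by (simp add: GT_def)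
  then have comp: "compact_space (mtopology_of U)" by (simp add: geodesic_tree_def metric_tree_def)
  note cont = bilipschitz_with_imp_continuous_inj(1)[OF f] and inj = bilipschitz_with_imp_continuous_inj(2)[OF f]
  define F where "F w = f (plane_code w)" for w
  define \<eta> where "\<eta> = h a"
  have \<eta>: "0 < \<eta>" "\<eta> \<le> a" "\<eta> \<le> 1 - a" using a h_le[of a] by (auto simp: \<eta>_def)
  have FU: "F w \<in> mspace U" if "w \<in> S" for w
    using f(1) that unfolding F_def bilipschitz_with_def by auto
  have Finj: "F w = F w' \<Longrightarrow> w = w'" if "w \<in> S" "w' \<in> S" for w w'
    using inj_onD[OF inj, of "plane_code w" "plane_code w'"] that unfolding F_def
    by (simp add: inj_eq[OF inj_plane_code])
  have base: "(x, 0) \<in> S" if "0 \<le> x" "x \<le> 1" for x using that h_nonneg by (simp add: comb_points_def)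
  have hair: "(a, y) \<in> S" if "0 \<le> y" "y \<le> \<eta>" for y using that \<eta> by (simp add: comb_points_def \<eta>_def)
  let ?q = "F (a, 0)"
  have q: "(a, 0) \<in> S" "?q \<in> mspace U" using base[of a] FU[of "(a, 0)"] \<eta> by auto
  let ?X = "subtopology (mtopology_of U) (mspace U - {?q})"
  have avoid: "F w \<in> mspace U - {?q}" if "w \<in> S - {(a, 0)}" for w
    using FU[of w] Finj[of w "(a, 0)"] that q(1) by auto
  have arm: "\<exists>C\<in>branches U ?q. F ` A \<subseteq> C" if A: "connected A" "A \<subseteq> S - {(a, 0)}" for A
  proof -
    have "connectedin (mtopology_of U) (f ` plane_code ` A)"
      using A(2) by (intro connectedin_continuous_map_image[OF cont] connectedin_comb[OF A(1)]) blast
    then have "connectedin (mtopology_of U) (F ` A)" by (simp add: F_def image_image)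
    moreover have "F ` A \<subseteq> mspace U - {?q}" using A(2) by (intro image_subsetI avoid) blast
    ultimately have "connectedin ?X (F ` A)" by (simp add: connectedin_subtopology)
    moreover have "?X \<noteq> trivial_topology"
    proof -
      have "(0, 0) \<noteq> (a, 0)" "(0, 0) \<in> S" using \<eta> base[of 0] by auto
      then have "F (0, 0) \<in> mspace U - {?q}" by (intro avoid) simp
      then show ?thesis using null_topspace_iff_trivial[of ?X] by auto
    qed
    ultimately show ?thesis
      unfolding branches_def using exists_connected_component_of_superset[of ?X "F ` A"] by auto
  qed
  have far: "\<eta> / (2 * k) \<le> mdiam U C"
    if "C \<in> branches U ?q" "w \<in> S" "w' \<in> S" "F w \<in> C" "F w' \<in> C" "comb_dist w w' = \<eta> / 2" for C w w'
  proof -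
    have "C \<subseteq> mspace U" using connected_components_of_subset[of C ?X] that(1) by (auto simp: branches_def)
    then have "mdist U (F w) (F w') \<le> mdiam U C" by (rule mdist_le_mdiam[OF comp _ that(4,5)])
    moreover have "comb_dist w w' / k \<le> mdist U (F w) (F w')"
      using f(1) that(2,3) unfolding bilipschitz_with_def F_def by (metis imageI mdist_comb mspace_comb)
    ultimately show ?thesis using that(6) by (simp add: field_simps)
  qed
  have distinct: "C \<noteq> C'"
    if "C \<in> branches U ?q" "C' \<in> branches U ?q" "w \<in> S" "w' \<in> S" "F w \<in> C" "F w' \<in> C'"
      "comb_dist w (a, 0) + comb_dist (a, 0) w' = comb_dist w w'" for C C' w w'
  proof (rule geodesic_tree_distinct_branches[OF tree that(1,2,5,6) q(2)])
    show "mdist U (F w) ?q + mdist U ?q (F w') = mdist U (F w) (F w')"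
      unfolding F_def using that(3,4,7) q(1)
      by (intro embedding_preserves_between[OF geodesic_comb tree cont inj]) auto
  qed
  \<comment> \<open>The outer halves of the arms to the left, to the right and upwards.\<close>
  define L where "L = {a - \<eta>..a - \<eta> / 2} \<times> {0::real}"
  define R where "R = {a + \<eta> / 2..a + \<eta>} \<times> {0::real}"
  define H where "H = {a} \<times> {\<eta> / 2..\<eta>}"
  have "connected L" "connected R" "connected H"
    unfolding L_def R_def H_def by (auto intro!: convex_connected convex_Times)
  moreover have "L \<subseteq> S - {(a, 0)}" "R \<subseteq> S - {(a, 0)}" "H \<subseteq> S - {(a, 0)}"
    unfolding L_def R_def H_def using \<eta> base hair by auto
  ultimately obtain CL CR CH where CL: "CL \<in> branches U ?q" "F ` L \<subseteq> CL"
    and CR: "CR \<in> branches U ?q" "F ` R \<subseteq> CR" and CH: "CH \<in> branches U ?q" "F ` H \<subseteq> CH"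
    using arm by meson
  have mem: "F (a - \<eta>, 0) \<in> CL" "F (a - \<eta> / 2, 0) \<in> CL" "F (a + \<eta>, 0) \<in> CR" "F (a + \<eta> / 2, 0) \<in> CR"
    "F (a, \<eta>) \<in> CH" "F (a, \<eta> / 2) \<in> CH"
    using CL(2) CR(2) CH(2) \<eta>(1) by (auto simp: L_def R_def H_def)
  have S: "(a - \<eta>, 0) \<in> S" "(a - \<eta> / 2, 0) \<in> S" "(a + \<eta>, 0) \<in> S" "(a + \<eta> / 2, 0) \<in> S" "(a, \<eta>) \<in> S" "(a, \<eta> / 2) \<in> S"
    using \<eta> by (auto intro!: base hair)
  have "CL \<noteq> CR" by (rule distinct[OF CL(1) CR(1) S(1,3) mem(1,3)]) (use \<eta>(1) in \<open>simp add: comb_dist_def\<close>)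
  moreover have "CL \<noteq> CH" by (rule distinct[OF CL(1) CH(1) S(1,5) mem(1,5)]) (use \<eta>(1) in \<open>simp add: comb_dist_def\<close>)
  moreover have "CR \<noteq> CH" by (rule distinct[OF CR(1) CH(1) S(3,5) mem(3,5)]) (use \<eta>(1) in \<open>simp add: comb_dist_def\<close>)
  ultimately have card: "card {CL, CR, CH} = 3" by simp
  have "\<eta> / (2 * k) \<le> mdiam U CL" by (rule far[OF CL(1) S(1,2) mem(1,2)]) (use \<eta>(1) in \<open>simp add: comb_dist_def\<close>)
  moreover have "\<eta> / (2 * k) \<le> mdiam U CR" by (rule far[OF CR(1) S(3,4) mem(3,4)]) (use \<eta>(1) in \<open>simp add: comb_dist_def\<close>)
  moreover have "\<eta> / (2 * k) \<le> mdiam U CH" by (rule far[OF CH(1) S(5,6) mem(5,6)]) (use \<eta>(1) in \<open>simp add: comb_dist_def\<close>)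
  ultimately have diam: "\<And>C. C \<in> {CL, CR, CH} \<Longrightarrow> \<eta> / (2 * k) \<le> mdiam U C" by blast
  have sub: "{CL, CR, CH} \<subseteq> branches U ?q" using CL CR CH by blast
  show ?thesis
    using height_ge[OF GT_finite_branches[OF U q(2)] sub card diam] q(2)
    unfolding high_branch_points_def branch_points_def F_def \<eta>_def by simp
qed

text \<open>The positions on the segment from \<open>u\<close> to \<open>v\<close> of the branch points that can be images of feet with
  hairs of length \<open>len * r\<close>, measured in units of \<open>len\<close>. The factor \<open>\<kappa>\<close> is the possible loss of height.\<close>

definition positions :: "'a metric \<Rightarrow> real \<Rightarrow> real \<Rightarrow> 'a \<Rightarrow> 'a \<Rightarrow> real \<Rightarrow> real set" where
  "positions U \<kappa> len u v r = {mdist U u q / len | q. q \<in> high_branch_points U (len * r / \<kappa>) \<and> mdist U u q + mdist U q v = mdist U u v}"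

lemma separated_family_positions:
  assumes U: "U \<in> GT n c" and pos: "0 < c" "0 < \<kappa>" "0 < len" and uv: "u \<in> mspace U" "v \<in> mspace U"
  shows "separated_family (c / \<kappa>) (positions U \<kappa> len u v)"
  unfolding separated_family_def
proof (intro conjI allI ballI impI)
  have tree: "geodesic_tree U" using U by (simp add: GT_def)
  fix r x y assume r: "0 < r" and xy: "x \<in> positions U \<kappa> len u v r" "y \<in> positions U \<kappa> len u v r" "x \<noteq> y"
  obtain p where p: "x = mdist U u p / len" "p \<in> high_branch_points U (len * r / \<kappa>)" "mdist U u p + mdist U p v = mdist U u v"
    using xy(1) unfolding positions_def by blast
  obtain q where q: "y = mdist U u q / len" "q \<in> high_branch_points U (len * r / \<kappa>)" "mdist U u q + mdist U q v = mdist U u v"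
    using xy(2) unfolding positions_def by blast
  have "p \<in> mspace U" "q \<in> mspace U" using p(2) q(2) by (auto simp: high_branch_points_def branch_points_def)
  then have d: "mdist U p q = \<bar>mdist U u p - mdist U u q\<bar>"
    by (rule geodesic_tree_between_dist[OF tree uv _ _ p(3) q(3)])
  have "p \<noteq> q" using xy(3) p(1) q(1) by auto
  then have "c * (len * r / \<kappa>) \<le> \<bar>mdist U u p - mdist U u q\<bar>"
    using high_branch_points_separated[OF U pos(1) p(2) q(2)] d by simp
  moreover have "\<bar>mdist U u p - mdist U u q\<bar> = len * \<bar>x - y\<bar>"
    using pos(3) by (simp add: p(1) q(1) abs_divide flip: diff_divide_distrib)
  ultimately have "len * (c / \<kappa> * r) \<le> len * \<bar>x - y\<bar>" by (simp add: mult_ac)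
  then show "c / \<kappa> * r \<le> \<bar>x - y\<bar>" by (rule mult_left_le_imp_le[OF _ pos(3)])
next
  fix r r' :: real assume "0 < r" "r \<le> r'"
  then have "len * r / \<kappa> \<le> len * r' / \<kappa>" using pos by (intro divide_right_mono mult_left_mono) auto
  then show "positions U \<kappa> len u v r' \<subseteq> positions U \<kappa> len u v r"
    unfolding positions_def high_branch_points_def by fastforce
qed

section \<open>One block of the base for each constant\<close>

text \<open>The blocks shrink towards \<open>0\<close>. A length of a quarter of the starting point leaves gaps that are
  longer than the hairs on either side.\<close>

definition block_start :: "nat \<Rightarrow> real" where
  "block_start m = (1 / 2) ^ Suc m"

definition block_length :: "nat \<Rightarrow> real" where
  "block_length m = block_start m / 4"

definition block :: "nat \<Rightarrow> real set" where
  "block m = {block_start m..block_start m + block_length m}"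

definition assembled_heights :: "(nat \<Rightarrow> real \<Rightarrow> real) \<Rightarrow> real \<Rightarrow> real" where
  "assembled_heights H x = (if \<exists>m. x \<in> block m then
      let m = THE m. x \<in> block m in block_length m * H m ((x - block_start m) / block_length m) else 0)"

lemma block_pos: "0 < block_start m" "0 < block_length m"
  by (auto simp: block_length_def block_start_def)

lemma block_start_le: "block_start m \<le> 1 / 2"
  using power_decreasing[of 1 "Suc m" "1 / 2 :: real"] by (simp add: block_start_def)

lemma block_gap:
  assumes "i < j" "x \<in> block i" "y \<in> block j"
  shows "block_length i \<le> x - y" "block_length j \<le> block_length i"
proof -
  have "block_start j \<le> (1 / 2) ^ Suc (Suc i)"
    unfolding block_start_def using assms(1) by (intro power_decreasing) auto
  then have j: "block_start j \<le> block_start i / 2" by (simp add: block_start_def)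
  then show "block_length i \<le> x - y" using assms(2,3) block_pos(1)[of i] by (simp add: block_def block_length_def)
  show "block_length j \<le> block_length i" using j block_pos(1)[of i] by (simp add: block_length_def)
qed

lemma block_unique: "x \<in> block i \<Longrightarrow> x \<in> block j \<Longrightarrow> i = j"
  using block_gap(1)[of i j x x] block_gap(1)[of j i x x] block_pos(2)[of i] block_pos(2)[of j]
  by (cases i j rule: linorder_cases) auto

lemma assembled_heights_block:
  assumes "x \<in> block m"
  shows "assembled_heights H x = block_length m * H m ((x - block_start m) / block_length m)"
proof -
  have "(THE m. x \<in> block m) = m" using assms block_unique by blast
  then show ?thesis using assms by (auto simp: assembled_heights_def)
qed

lemma assembled_heights_outside: "(\<And>m. x \<notin> block m) \<Longrightarrow> assembled_heights H x = 0"
  by (simp add: assembled_heights_def)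

lemma comb_heights_assembled:
  assumes H: "\<And>m x. 0 \<le> H m x \<and> H m x \<le> 1 / 4"
    and sep: "\<And>m x y. x \<noteq> y \<Longrightarrow> min (H m x) (H m y) \<le> \<bar>x - y\<bar>"
  shows "comb_heights (assembled_heights H)"
proof
  have nonneg: "0 \<le> assembled_heights H x" for x
  proof (cases "\<exists>m. x \<in> block m")
    case True
    then obtain m where "x \<in> block m" by blast
    then show ?thesis using H block_pos(2)[of m] by (simp add: assembled_heights_block)
  qed (simp add: assembled_heights_outside)
  show "0 \<le> assembled_heights H x" for x by (rule nonneg)
  have le: "assembled_heights H x \<le> block_length m / 4" if "x \<in> block m" for x m
    using mult_left_mono[of "H m ((x - block_start m) / block_length m)" "1 / 4" "block_length m"] H block_pos(2)[of m]
    by (simp add: assembled_heights_block[OF that])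
  show "assembled_heights H x \<le> x \<and> assembled_heights H x \<le> 1 - x" if pos: "0 < assembled_heights H x" for x
  proof -
    obtain m where m: "x \<in> block m" using pos assembled_heights_outside[of x H] by fastforce
    show ?thesis
      using le[OF m] m block_pos(1)[of m] block_start_le[of m] by (auto simp: block_def block_length_def)
  qed
  show "min (assembled_heights H x) (assembled_heights H y) \<le> \<bar>x - y\<bar>" if "x \<noteq> y" for x y
  proof (cases "(\<exists>m. x \<in> block m) \<and> (\<exists>m. y \<in> block m)")
    case True
    then obtain i j where ij: "x \<in> block i" "y \<in> block j" by blast
    show ?thesis
    proof (cases i j rule: linorder_cases)
      case equal
      let ?l = "block_length i" and ?x = "(x - block_start i) / block_length i" and ?y = "(y - block_start i) / block_length i"
      have l: "?l > 0" by (rule block_pos)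
      have "?x \<noteq> ?y" using that l by simp
      then have "?l * min (H i ?x) (H i ?y) \<le> ?l * \<bar>?x - ?y\<bar>" using sep l by (intro mult_left_mono) auto
      also have "\<dots> = \<bar>x - y\<bar>" using l by (simp add: abs_divide flip: diff_divide_distrib)
      finally show ?thesis
        using l ij equal by (simp add: assembled_heights_block min_mult_distrib_left)
    next
      case less
      then show ?thesis using block_gap[OF less ij] le[OF ij(2)] block_pos(2)[of j] by linarith
    next
      case greater
      then show ?thesis using block_gap[OF greater ij(2,1)] le[OF ij(1)] block_pos(2)[of i] by linarith
    qed
  next
    case False
    then have "assembled_heights H x = 0 \<or> assembled_heights H y = 0" using assembled_heights_outside by blast
    then show ?thesis by (auto simp: min_le_iff_disj)
  qed
qed

text \<open>On the block of the constant \<open>k\<close>, rescaled to \<open>[0,1]\<close>, the map \<open>g\<close> is the distance from the image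
  of the left end of the block. The heights at both ends are prescribed in order that the images of the
  ends belong to a finite set that is known before \<open>H m\<close> is chosen.\<close>

lemma embedding_yields_excluded_map:
  fixes H :: "nat \<Rightarrow> real \<Rightarrow> real" and m :: nat
  defines "k \<equiv> real (Suc m)" and "h \<equiv> assembled_heights H" and "len \<equiv> block_length m"
  assumes h: "comb_heights h" and U: "U \<in> GT n c"
    and f: "bilipschitz_with k (comb h) U f"
    and ends: "H m 0 = 1 / 4" "H m 1 = 1 / 4"
  shows "\<exists>u\<in>high_branch_points U (len / 4 / (2 * k)). \<exists>v\<in>high_branch_points U (len / 4 / (2 * k)). 
     \<exists>g. g 0 = 0 \<and> increments_within k g \<and> (\<forall>x\<in>{0..1}. 0 < H m x \<longrightarrow> g x \<in> positions U (2 * k) len u v (H m x))"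
proof -
  interpret comb_heights h by fact
  have k: "0 < k" by (simp add: k_def)
  have len: "0 < len" using block_pos(2) by (simp add: len_def)
  have tree: "geodesic_tree U" using U by (simp add: GT_def)
  note cont = bilipschitz_with_imp_continuous_inj(1)[OF f k] and inj = bilipschitz_with_imp_continuous_inj(2)[OF f k]
  define a where "a = block_start m"
  define b where "b t = f (plane_code (a + len * t, 0))" for t
  have in01: "0 \<le> a + len * t" "a + len * t \<le> 1" if "t \<in> {0..1}" for t
  proof -
    have "0 \<le> len * t" "len * t \<le> len * 1" using that len by (auto intro: mult_left_mono)
    moreover have "0 < a" "a \<le> 1 / 2" "len \<le> 1 / 8"
      using block_pos(1)[of m] block_start_le[of m] by (auto simp: a_def len_def block_length_def)
    ultimately show "0 \<le> a + len * t" "a + len * t \<le> 1" by linarith+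
  qed
  have base: "(a + len * t, 0) \<in> S" if "t \<in> {0..1}" for t
    using in01[OF that] h_nonneg by (simp add: comb_points_def)
  have h_block: "h (a + len * t) = len * H m t" if "t \<in> {0..1}" for t
  proof -
    have "0 \<le> len * t" "len * t \<le> len * 1" using that len by (auto intro: mult_left_mono)
    then have "a + len * t \<in> block m" by (simp add: block_def a_def len_def)
    then show ?thesis using len unfolding h_def by (simp add: assembled_heights_block a_def len_def)
  qed
  have foot: "b t \<in> high_branch_points U (len * H m t / (2 * k))" if "t \<in> {0..1}" "0 < H m t" for t
    using foot_image_high_branch_point[OF U f k, of "a + len * t"] that len unfolding h_block[OF that(1)] b_def by simp
  have dist: "mdist (comb h) (plane_code (a + len * s, 0)) (plane_code (a + len * t, 0)) = len * (t - s)" if "s \<le> t" for s t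
    using that len by (auto simp: comb_dist_def right_diff_distrib)
  have between: "mdist U (b r) (b s) + mdist U (b s) (b t) = mdist U (b r) (b t)"
    if "0 \<le> r" "r \<le> s" "s \<le> t" "t \<le> 1" for r s t
    unfolding b_def
  proof (rule embedding_preserves_between[OF geodesic_comb tree cont inj])
    show "mdist (comb h) (plane_code (a + len * r, 0)) (plane_code (a + len * s, 0)) +
        mdist (comb h) (plane_code (a + len * s, 0)) (plane_code (a + len * t, 0)) =
        mdist (comb h) (plane_code (a + len * r, 0)) (plane_code (a + len * t, 0))"
      using that by (simp only: dist order_trans[OF that(2,3)]) (simp add: algebra_simps)
  qed (use that base in auto)
  define g where "g t = mdist U (b 0) (b t) / len" for t
  have "b 0 \<in> mspace U"
    using foot[of 0] ends by (auto simp: high_branch_points_def branch_points_def)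
  then have "g 0 = 0" by (simp add: g_def)
  moreover have "increments_within k g"
    unfolding increments_within_def
  proof (intro allI impI)
    fix s t :: real assume st: "0 \<le> s" "s \<le> t" "t \<le> 1"
    have "mdist U (b 0) (b t) - mdist U (b 0) (b s) = mdist U (b s) (b t)"
      using between[of 0 s t] st by simp
    then have g: "g t - g s = mdist U (b s) (b t) / len" by (simp add: g_def flip: diff_divide_distrib)
    have "len * (t - s) / k \<le> mdist U (b s) (b t)" "mdist U (b s) (b t) \<le> k * (len * (t - s))"
      using f base[of s] base[of t] st unfolding bilipschitz_with_def dist[OF st(2), symmetric] b_def by auto
    then show "(t - s) / k \<le> g t - g s \<and> g t - g s \<le> k * (t - s)"
      unfolding g using len by (simp add: pos_le_divide_eq pos_divide_le_eq mult_ac)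
  qed
  moreover have "g x \<in> positions U (2 * k) len (b 0) (b 1) (H m x)" if "x \<in> {0..1}" "0 < H m x" for x
    using foot[OF that] between[of 0 x 1] that unfolding positions_def g_def by auto
  moreover have "b 0 \<in> high_branch_points U (len / 4 / (2 * k))" "b 1 \<in> high_branch_points U (len / 4 / (2 * k))"
    using foot[of 0] foot[of 1] ends by auto
  ultimately show ?thesis by blast
qed

text \<open>The finitely many families to be defeated on the block \<open>m\<close> come from the pairs of branch points of \<open>U\<close> that are
  possible images of the ends of the block.\<close>

theorem GT_not_universal:
  assumes U: "U \<in> GT n c" and c: "0 < c"
  shows "\<exists>h. comb_heights h \<and> (\<nexists>f. bilipschitz_embedding (comb h) U f)"
proof -
  define \<X> where "\<X> m = (\<lambda>(u, v). positions U (2 * real (Suc m)) (block_length m) u v) `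
     (high_branch_points U (block_length m / 4 / (2 * real (Suc m))) \<times> high_branch_points U (block_length m / 4 / (2 * real (Suc m))))" for m
  define Q where "Q m h \<longleftrightarrow> (\<forall>x. 0 \<le> h x \<and> h x \<le> 1 / 4) \<and> h 0 = 1 / 4 \<and> h 1 = 1 / 4 \<and>
     (\<forall>x y. x \<noteq> y \<longrightarrow> min (h x) (h y) \<le> \<bar>x - y\<bar>) \<and>
     (\<forall>X\<in>\<X> m. \<nexists>g. g 0 = 0 \<and> increments_within (real (Suc m)) g \<and> (\<forall>x\<in>{0..1}. 0 < h x \<longrightarrow> g x \<in> X (h x)))"
    for m and h :: "real \<Rightarrow> real"
  have "\<exists>h. Q m h" for m
    unfolding Q_def
  proof (rule heights_defeating_bilipschitz_maps)
    show "finite (\<X> m)"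
      unfolding \<X>_def using block_pos(2)[of m]
      by (intro finite_imageI finite_cartesian_product finite_high_branch_points[OF U c]) simp_all
    show "separated_family (c / (2 * real (Suc m))) X" if X: "X \<in> \<X> m" for X
    proof -
      obtain u v where "X = positions U (2 * real (Suc m)) (block_length m) u v" "u \<in> mspace U" "v \<in> mspace U"
        using X unfolding \<X>_def high_branch_points_def branch_points_def by auto
      then show ?thesis using separated_family_positions[OF U c, of "2 * real (Suc m)" "block_length m" u v] block_pos(2)[of m] by simp
    qed
    show "0 < c / (2 * real (Suc m))" "0 < real (Suc m)" using c by auto
  qed
  then obtain H where H: "\<And>m. Q m (H m)" by metis
  have comb: "comb_heights (assembled_heights H)"
    by (rule comb_heights_assembled) (use H in \<open>auto simp: Q_def\<close>)
  have "\<not> bilipschitz_embedding (comb (assembled_heights H)) U f" for f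
  proof
    assume "bilipschitz_embedding (comb (assembled_heights H)) U f"
    then obtain m where m: "bilipschitz_with (real (Suc m)) (comb (assembled_heights H)) U f"
      using bilipschitz_embedding_nat_constant by blast
    have "H m 0 = 1 / 4" "H m 1 = 1 / 4" using H[of m] by (auto simp: Q_def)
    from embedding_yields_excluded_map[OF comb U m this] obtain u v g where
      uv: "u \<in> high_branch_points U (block_length m / 4 / (2 * real (Suc m)))"
        "v \<in> high_branch_points U (block_length m / 4 / (2 * real (Suc m)))"
      and g: "g 0 = 0" "increments_within (real (Suc m)) g"
        "\<forall>x\<in>{0..1}. 0 < H m x \<longrightarrow> g x \<in> positions U (2 * real (Suc m)) (block_length m) u v (H m x)"
      by (elim bexE exE conjE) (rule that)
    have "positions U (2 * real (Suc m)) (block_length m) u v \<in> \<X> m"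
      unfolding \<X>_def using uv by (intro image_eqI[of _ _ "(u, v)"]) auto
    then have "\<nexists>g. g 0 = 0 \<and> increments_within (real (Suc m)) g \<and>
        (\<forall>x\<in>{0..1}. 0 < H m x \<longrightarrow> g x \<in> positions U (2 * real (Suc m)) (block_length m) u v (H m x))"
      using H[of m] unfolding Q_def by (elim conjE bspec)
    then show False using g by (elim notE) (intro exI[of _ g] conjI)
  qed
  then show ?thesis using comb by blast
qed

theorem corollary1p2:
  shows "(\<forall>n\<ge>3. \<forall>c\<in>{0<..<1}.
            \<not> (\<exists>U \<in> (GT n c :: 'a metric set).
                 bilipschitz_universal U (GT n c :: real metric set)))
       \<and> \<not> (\<exists>U \<in> (\<Union>n\<in>{3..}. \<Union>c\<in>{0<..<1}. GT n c :: 'a metric set).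
               bilipschitz_universal U (\<Union>n\<in>{3..}. \<Union>c\<in>{0<..<1}. GT n c :: real metric set))"
proof -
  have *: "\<not> bilipschitz_universal U \<C>"
    if U: "U \<in> (GT n c :: 'a metric set)" and nc: "n \<ge> 3" "0 < c" "c < 1" and sub: "GT n c \<subseteq> \<C>" for U n c and \<C> :: "real metric set"
  proof -
    obtain h where h: "comb_heights h" "\<nexists>f. bilipschitz_embedding (comb h) U f"
      using GT_not_universal[OF U nc(2)] by blast
    have "comb h \<in> GT n c" using comb_heights.comb_in_GT[OF h(1) nc(1,2)] nc(3) by simp
    then show ?thesis using h(2) sub unfolding bilipschitz_universal_def by blast
  qed
  show ?thesis
  proof (intro conjI allI impI ballI notI; elim bexE UN_E)
    fix n c and U :: "'a metric" assume "3 \<le> n" "c \<in> {0<..<1}" "U \<in> GT n c" "bilipschitz_universal U (GT n c :: real metric set)"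
    then show False using *[of U n c "GT n c"] by simp
  next
    fix U :: "'a metric" and n c
    assume "bilipschitz_universal U (\<Union>n\<in>{3..}. \<Union>c\<in>{0<..<1}. GT n c :: real metric set)"
      "n \<in> {3..}" "c \<in> {0<..<1}" "U \<in> GT n c"
    moreover from this have "GT n c \<subseteq> (\<Union>n\<in>{3..}. \<Union>c\<in>{0<..<1}. GT n c :: real metric set)" by blast
    ultimately show False using *[of U n c] by auto
  qed
qed

end
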